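(* Let $q\equiv0$ and let $d\nu$ be a (locally finite) signed Borel measure on $\mathbb{R}$ which is singular with respect to Lebesgue measure. Let $\mathrm{H}$ be the corresponding self-adjoint operator in $L^2(\mathbb{R})$, i.e. the maximal operator associated with $-\frac{d}{dx}\frac{d}{dP(x)}$, $dP=dx+d\nu$. If $\mathrm{H}$ is lower semibounded, then the negative part $d\nu_-$ of $d\nu$ is a discrete measure.
   Context: $d\nu=d\nu_++d\nu_-$ is the Jordan decomposition, where $d\nu_-(E)=d\nu(E\cap\Omega_-)\le0$ for a Hahn decomposition $\mathbb{R}=\Omega_+\cup\Omega_-$. A measure is called discrete if its topological support has only finitely many points in every bounded interval (so that it is a sum of point masses without finite accumulation points). Operator: $AC_{\mathrm{loc}}(\mathbb{R};dP)$ is the set of functions $f$ which are locally of bounded variation and whose Borel measure $df$ is absolutely continuous with respect to $dP$; then $df=f^{[1]}\,dP$ with $f^{[1]}\in L^1_{\mathrm{loc}}(\mathbb{R};dP)$ the quasi-derivative. $\mathrm{H}f=-(f^{[1]})'$ with $\mathrm{dom}(\mathrm{H})=\{f\in L^2(\mathbb{R}): f\in AC_{\mathrm{loc}}(\mathbb{R};dP),\ f^{[1]}\in AC_{\mathrm{loc}}(\mathbb{R}),\ (f^{[1]})'\in L^2(\mathbb{R})\}$; this operator is self-adjoint. *)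

theory Defs
  imports "HOL-Analysis.Analysis"
begin

section \<open>Locally finite signed Borel measures on the real line\<close>

definition bounded_borel :: "real set set" where
  "bounded_borel = {E \<in> sets borel. bounded E}"

text \<open>
  A locally finite signed measure need not be defined on unbounded sets (where
  infinity minus infinity may occur).  It is therefore a real-valued set function of
  which only the values on bounded Borel sets are meaningful.
\<close>

lemma bounded_borel_subset:
  "A \<in> bounded_borel \<Longrightarrow> B \<in> sets borel \<Longrightarrow> B \<subseteq> A \<Longrightarrow> B \<in> bounded_borel"
  unfolding bounded_borel_def using bounded_subset by blast

lemma bounded_borel_sets: "A \<in> bounded_borel \<Longrightarrow> A \<in> sets borel"
  by (simp add: bounded_borel_def)

lemma bounded_borel_Diff:
  "A \<in> bounded_borel \<Longrightarrow> B \<in> bounded_borel \<Longrightarrow> A - B \<in> bounded_borel"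
  by (rule bounded_borel_subset) (auto dest: bounded_borel_sets)

lemma bounded_borel_Int:
  "A \<in> bounded_borel \<Longrightarrow> B \<in> bounded_borel \<Longrightarrow> A \<inter> B \<in> bounded_borel"
  by (rule bounded_borel_subset) (auto dest: bounded_borel_sets)

definition signed_borel_measure :: "(real set \<Rightarrow> real) \<Rightarrow> bool" where
  "signed_borel_measure \<nu> \<longleftrightarrow>
     (\<forall>A :: nat \<Rightarrow> real set. range A \<subseteq> bounded_borel \<longrightarrow> disjoint_family A \<longrightarrow>
        bounded (\<Union>n. A n) \<longrightarrow> (\<lambda>n. \<nu> (A n)) sums \<nu> (\<Union>n. A n))"

definition lebesgue_singular :: "(real set \<Rightarrow> real) \<Rightarrow> bool" where
  "lebesgue_singular \<nu> \<longleftrightarrow>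
     (\<exists>N \<in> null_sets lborel. \<forall>E \<in> bounded_borel. E \<inter> N = {} \<longrightarrow> \<nu> E = 0)"

definition positive_set :: "(real set \<Rightarrow> real) \<Rightarrow> real set \<Rightarrow> bool" where
  "positive_set \<nu> S \<longleftrightarrow> (\<forall>E \<in> bounded_borel. E \<subseteq> S \<longrightarrow> 0 \<le> \<nu> E)"

definition negative_set :: "(real set \<Rightarrow> real) \<Rightarrow> real set \<Rightarrow> bool" where
  "negative_set \<nu> S \<longleftrightarrow> (\<forall>E \<in> bounded_borel. E \<subseteq> S \<longrightarrow> \<nu> E \<le> 0)"

definition hahn_decomposition :: "(real set \<Rightarrow> real) \<Rightarrow> real set \<Rightarrow> real set \<Rightarrow> bool" where
  "hahn_decomposition \<nu> Wp Wm \<longleftrightarrow>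
     Wp \<in> sets borel \<and> Wm \<in> sets borel \<and> Wp \<union> Wm = UNIV \<and> Wp \<inter> Wm = {} \<and>
     positive_set \<nu> Wp \<and> negative_set \<nu> Wm"

text \<open>
  The existence of a Hahn decomposition, which makes the choice in the definition of the
  Jordan decomposition below meaningful.
\<close>

context
  fixes \<nu> :: "real set \<Rightarrow> real"
  assumes sm: "signed_borel_measure \<nu>"
begin

lemma signed_sums:
  assumes "\<And>n::nat. A n \<in> bounded_borel" "disjoint_family A" "bounded (\<Union>n. A n)"
  shows "(\<lambda>n. \<nu> (A n)) sums \<nu> (\<Union>n. A n)"
  using sm assms unfolding signed_borel_measure_def by blast

lemma signed_empty: "\<nu> {} = 0"
proof -
  have "(\<lambda>n::nat. \<nu> {}) sums \<nu> (\<Union>n::nat. {})"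
    by (rule signed_sums) (auto simp: bounded_borel_def disjoint_family_on_def)
  then have "(\<lambda>n::nat. \<nu> {}) \<longlonglongrightarrow> 0"
    using sums_summable summable_LIMSEQ_zero by blast
  then show ?thesis
    by (simp add: LIMSEQ_const_iff)
qed

lemma signed_Un:
  assumes "A \<in> bounded_borel" "B \<in> bounded_borel" "A \<inter> B = {}"
  shows "\<nu> (A \<union> B) = \<nu> A + \<nu> B"
proof -
  have "(\<lambda>n::nat. \<nu> (binaryset A B n)) sums \<nu> (\<Union>n. binaryset A B n)"
    using assms
    by (intro signed_sums)
       (auto simp: binaryset_def disjoint_family_on_def bounded_borel_def UN_binaryset_eq[unfolded binaryset_def])
  moreover have "(\<lambda>n::nat. \<nu> (binaryset A B n)) sums (\<nu> A + \<nu> B)"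
    by (rule binaryset_sums) (rule signed_empty)
  ultimately show ?thesis
    by (metis UN_binaryset_eq sums_unique2)
qed

lemma signed_Diff:
  assumes "A \<in> bounded_borel" "B \<in> bounded_borel" "B \<subseteq> A"
  shows "\<nu> (A - B) = \<nu> A - \<nu> B"
  using signed_Un[of "A - B" B] assms bounded_borel_Diff[of A B] by (simp add: Un_absorb2 Int_commute)

lemma decreasing_sums:
  assumes A: "\<And>n::nat. A n \<in> bounded_borel" and dec: "\<And>n. A (Suc n) \<subseteq> A n"
  shows "(\<lambda>n. \<nu> (A n - A (Suc n))) sums \<nu> (A 0 - (\<Inter>n. A n))"
    and "(\<Inter>n. A n) \<in> bounded_borel"
    and "(\<Union>n. A n - A (Suc n)) = A 0 - (\<Inter>n. A n)"
    and "disjoint_family (\<lambda>n. A n - A (Suc n))"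
proof -
  have anti: "A n \<subseteq> A m" if "m \<le> n" for m n
    using lift_Suc_antimono_le[of A, OF dec that] .
  show un: "(\<Union>n. A n - A (Suc n)) = A 0 - (\<Inter>n. A n)"
  proof
    show "(\<Union>n. A n - A (Suc n)) \<subseteq> A 0 - (\<Inter>n. A n)"
      using anti[of 0] by blast
    show "A 0 - (\<Inter>n. A n) \<subseteq> (\<Union>n. A n - A (Suc n))"
    proof
      fix x assume x: "x \<in> A 0 - (\<Inter>n. A n)"
      define k where "k = (LEAST n. x \<notin> A n)"
      have "\<exists>n. x \<notin> A n" using x by blast
      then have k: "x \<notin> A k" unfolding k_def by (rule LeastI_ex)
      then obtain m where m: "k = Suc m"
        using x by (cases k) auto
      have "x \<in> A m"
        using not_less_Least[of m "\<lambda>n. x \<notin> A n"] m unfolding k_def by auto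
      then show "x \<in> (\<Union>n. A n - A (Suc n))"
        using k m by blast
    qed
  qed
  show "(\<Inter>n. A n) \<in> bounded_borel"
    using A bounded_borel_sets by (intro bounded_borel_subset[OF A[of 0]]) auto
  show disj: "disjoint_family (\<lambda>n. A n - A (Suc n))"
    unfolding disjoint_family_on_def
  proof (intro ballI impI)
    fix m n :: nat assume "m \<noteq> n"
    then consider "Suc m \<le> n" | "Suc n \<le> m" by linarith
    then show "(A m - A (Suc m)) \<inter> (A n - A (Suc n)) = {}"
      using anti[of "Suc m" n] anti[of "Suc n" m] by cases blast+
  qed
  have "bounded (A 0 - (\<Inter>n. A n))"
    using A[of 0] bounded_subset[of "A 0"] by (simp add: bounded_borel_def)
  then show "(\<lambda>n. \<nu> (A n - A (Suc n))) sums \<nu> (A 0 - (\<Inter>n. A n))"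
    using signed_sums[of "\<lambda>n. A n - A (Suc n)"] A disj un bounded_borel_Diff by auto
qed

lemma negative_subset:
  assumes D: "D \<in> bounded_borel"
  shows "\<exists>X \<in> bounded_borel. X \<subseteq> D \<and> \<nu> X \<le> \<nu> D \<and> negative_set \<nu> X"
proof -
  have large: "\<exists>G \<in> bounded_borel. G \<subseteq> A \<and> 0 \<le> \<nu> G \<and>
      (\<forall>F \<in> bounded_borel. F \<subseteq> A \<longrightarrow> min 1 (\<nu> F / 2) \<le> \<nu> G)" for A
  proof (cases "\<exists>F \<in> bounded_borel. F \<subseteq> A \<and> 1 \<le> \<nu> F")
    case True
    then obtain G where "G \<in> bounded_borel" "G \<subseteq> A" "1 \<le> \<nu> G" by blast
    then show ?thesis by (intro bexI[of _ G]) auto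
  next
    case False
    define S where "S = \<nu> ` {F \<in> bounded_borel. F \<subseteq> A}"
    have bdd: "bdd_above S"
      using False unfolding S_def by (intro bdd_aboveI[where M=1]) force
    have "{} \<in> bounded_borel" by (simp add: bounded_borel_def)
    then have zero: "0 \<in> S" unfolding S_def using signed_empty by force
    have upper: "\<nu> F \<le> Sup S" if "F \<in> bounded_borel" "F \<subseteq> A" for F
      using that bdd unfolding S_def by (intro cSup_upper) auto
    show ?thesis
    proof (cases "Sup S \<le> 0")
      case True
      then have "min 1 (\<nu> F / 2) \<le> \<nu> {}" if "F \<in> bounded_borel" "F \<subseteq> A" for F
        using upper[OF that] signed_empty by simp
      then show ?thesis
        using signed_empty \<open>{} \<in> bounded_borel\<close> by (intro bexI[of _ "{}"]) simp_all
    next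
      case False
      then have "Sup S / 2 < Sup S" by simp
      then obtain y where "y \<in> S" "Sup S / 2 < y"
        using less_cSup_iff[of S] zero bdd by blast
      then obtain G where G: "G \<in> bounded_borel" "G \<subseteq> A" "Sup S / 2 < \<nu> G"
        unfolding S_def by auto
      have "min 1 (\<nu> F / 2) \<le> \<nu> G" if "F \<in> bounded_borel" "F \<subseteq> A" for F
        using upper[OF that] G(3) by linarith
      then show ?thesis
        using G False by (intro bexI[of _ G]) simp_all
    qed
  qed
  let ?P = "\<lambda>(n::nat) A. A \<in> bounded_borel \<and> A \<subseteq> D \<and> \<nu> A \<le> \<nu> D"
  let ?Q = "\<lambda>(n::nat) A A'. A' \<subseteq> A \<and> 0 \<le> \<nu> (A - A') \<and>
      (\<forall>F \<in> bounded_borel. F \<subseteq> A \<longrightarrow> min 1 (\<nu> F / 2) \<le> \<nu> (A - A'))"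
  have "\<exists>f. \<forall>n. ?P n (f n) \<and> ?Q n (f n) (f (Suc n))"
  proof (rule dependent_nat_choice)
    show "\<exists>A. ?P 0 A" using D by blast
    fix A and n :: nat assume A: "?P n A"
    obtain G where G: "G \<in> bounded_borel" "G \<subseteq> A" "0 \<le> \<nu> G"
      "\<forall>F \<in> bounded_borel. F \<subseteq> A \<longrightarrow> min 1 (\<nu> F / 2) \<le> \<nu> G"
      using large by blast
    have "A - (A - G) = G" using G by blast
    then show "\<exists>A'. ?P (Suc n) A' \<and> ?Q n A A'"
      using A G signed_Diff[of A G] bounded_borel_Diff[of A G]
      by (intro exI[of _ "A - G"]) auto
  qed
  then obtain A where PQ: "\<forall>n. ?P n (A n) \<and> ?Q n (A n) (A (Suc n))"
    by (rule exE)
  note P = PQ[THEN spec, THEN conjunct1] and Q = PQ[THEN spec, THEN conjunct2]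
  note dec = decreasing_sums[of A, OF conjunct1[OF P] conjunct1[OF Q]]
  let ?X = "\<Inter>n. A n"
  have "\<nu> ?X = \<nu> (A 0) - \<nu> (A 0 - ?X)"
    using signed_Diff[of "A 0" ?X] P[of 0] dec(2) by (simp add: INT_lower)
  moreover have "0 \<le> \<nu> (A 0 - ?X)"
    using Q sums_le[OF _ sums_zero dec(1)] by auto
  ultimately have "\<nu> ?X \<le> \<nu> D" using P[of 0] by linarith
  moreover have "negative_set \<nu> ?X"
    unfolding negative_set_def
  proof (intro ballI impI)
    fix F assume F: "F \<in> bounded_borel" "F \<subseteq> ?X"
    have "(\<lambda>n. \<nu> (A n - A (Suc n))) \<longlonglongrightarrow> 0"
      using dec(1) sums_summable summable_LIMSEQ_zero by blast
    moreover have "min 1 (\<nu> F / 2) \<le> \<nu> (A n - A (Suc n))" for n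
      using Q[of n] F by blast
    ultimately have "min 1 (\<nu> F / 2) \<le> 0"
      by (intro LIMSEQ_le_const) auto
    then show "\<nu> F \<le> 0" by (auto simp: min_def split: if_splits)
  qed
  ultimately show ?thesis
    using dec(2) P[of 0] by blast
qed

end

context
  fixes \<nu> :: "real set \<Rightarrow> real"
  assumes sm: "signed_borel_measure \<nu>"
begin

lemma negative_subset_small:
  "\<exists>G \<in> bounded_borel. G \<subseteq> A \<and> negative_set \<nu> G \<and>
     (\<forall>F \<in> bounded_borel. F \<subseteq> A \<longrightarrow> \<nu> G \<le> max (-1) (\<nu> F / 2))"
proof -
  have "\<exists>H \<in> bounded_borel. H \<subseteq> A \<and>
      (\<forall>F \<in> bounded_borel. F \<subseteq> A \<longrightarrow> \<nu> H \<le> max (-1) (\<nu> F / 2))"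
  proof (cases "\<exists>F \<in> bounded_borel. F \<subseteq> A \<and> \<nu> F \<le> -1")
    case True
    then obtain G where "G \<in> bounded_borel" "G \<subseteq> A" "\<nu> G \<le> -1" by blast
    then show ?thesis by (meson max.coboundedI1)
  next
    case False
    define S where "S = \<nu> ` {F \<in> bounded_borel. F \<subseteq> A}"
    have bdd: "bdd_below S"
      using False unfolding S_def by (intro bdd_belowI[where m="-1"]) (auto simp: not_le intro: less_imp_le)
    have E: "{} \<in> bounded_borel" by (simp add: bounded_borel_def)
    then have zero: "0 \<in> S" unfolding S_def using signed_empty[OF sm] by force
    have lower: "Inf S \<le> \<nu> F" if "F \<in> bounded_borel" "F \<subseteq> A" for F
      using that bdd unfolding S_def by (intro cInf_lower) auto
    show ?thesis
    proof (cases "0 \<le> Inf S")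
      case True
      then have "\<nu> {} \<le> max (-1) (\<nu> F / 2)" if "F \<in> bounded_borel" "F \<subseteq> A" for F
        using lower[OF that] signed_empty[OF sm] by simp
      then show ?thesis
        using E by blast
    next
      case False
      then have "Inf S < Inf S / 2" by simp
      then obtain y where "y \<in> S" "y < Inf S / 2"
        using cInf_lessD[of S] zero by (metis empty_iff)
      then obtain G where G: "G \<in> bounded_borel" "G \<subseteq> A" "\<nu> G < Inf S / 2"
        unfolding S_def by auto
      have "\<nu> G \<le> max (-1) (\<nu> F / 2)" if "F \<in> bounded_borel" "F \<subseteq> A" for F
        using lower[OF that] G(3) by linarith
      then show ?thesis
        using G(1,2) by blast
    qed
  qed
  then obtain H where H: "H \<in> bounded_borel" "H \<subseteq> A"
    "\<forall>F \<in> bounded_borel. F \<subseteq> A \<longrightarrow> \<nu> H \<le> max (-1) (\<nu> F / 2)"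
    by (elim bexE conjE)
  obtain G where G: "G \<in> bounded_borel" "G \<subseteq> H" "\<nu> G \<le> \<nu> H" "negative_set \<nu> G"
    using negative_subset[OF sm H(1)] by blast
  have "\<nu> G \<le> max (-1) (\<nu> F / 2)" if "F \<in> bounded_borel" "F \<subseteq> A" for F
    using order.trans[OF G(3) H(3)[rule_format, OF that]] .
  moreover have "G \<subseteq> A" using G(2) H(2) by (rule subset_trans)
  ultimately show ?thesis
    using G(1,4) by blast
qed

lemma hahn_bounded:
  assumes D: "D \<in> bounded_borel"
  shows "\<exists>N \<in> bounded_borel. N \<subseteq> D \<and> negative_set \<nu> N \<and> positive_set \<nu> (D - N)"
proof -
  let ?P = "\<lambda>(n::nat) A. A \<in> bounded_borel \<and> (n = 0 \<longrightarrow> A = D)"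
  let ?Q = "\<lambda>(n::nat) A A'. A' \<subseteq> A \<and> negative_set \<nu> (A - A') \<and>
      (\<forall>F \<in> bounded_borel. F \<subseteq> A \<longrightarrow> \<nu> (A - A') \<le> max (-1) (\<nu> F / 2))"
  have "\<exists>f. \<forall>n. ?P n (f n) \<and> ?Q n (f n) (f (Suc n))"
  proof (rule dependent_nat_choice)
    show "\<exists>A. ?P 0 A" using D by blast
    fix A and n :: nat assume A: "?P n A"
    obtain G where G: "G \<in> bounded_borel" "G \<subseteq> A" "negative_set \<nu> G"
      "\<forall>F \<in> bounded_borel. F \<subseteq> A \<longrightarrow> \<nu> G \<le> max (-1) (\<nu> F / 2)"
      using negative_subset_small by blast
    have "A - (A - G) = G" using G by blast
    then show "\<exists>A'. ?P (Suc n) A' \<and> ?Q n A A'"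
      using A G(3,4) bounded_borel_Diff[OF _ G(1), of A]
      by (intro exI[of _ "A - G"]) simp
  qed
  then obtain A where PQ: "\<forall>n. ?P n (A n) \<and> ?Q n (A n) (A (Suc n))"
    by (rule exE)
  note P = PQ[THEN spec, THEN conjunct1] and Q = PQ[THEN spec, THEN conjunct2]
  note dec = decreasing_sums[OF sm, of A, OF conjunct1[OF P] conjunct1[OF Q]]
  let ?X = "\<Inter>n. A n"
  have A0: "A 0 = D" using P[of 0] by simp
  have "positive_set \<nu> ?X"
    unfolding positive_set_def
  proof (intro ballI impI)
    fix F assume F: "F \<in> bounded_borel" "F \<subseteq> ?X"
    have "(\<lambda>n. \<nu> (A n - A (Suc n))) \<longlonglongrightarrow> 0"
      using dec(1) sums_summable summable_LIMSEQ_zero by blast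
    moreover have "\<nu> (A n - A (Suc n)) \<le> max (-1) (\<nu> F / 2)" for n
      using Q[of n] F by blast
    ultimately have "0 \<le> max (-1) (\<nu> F / 2)"
      by (intro LIMSEQ_le_const2) auto
    then show "0 \<le> \<nu> F" by (auto simp: max_def split: if_splits)
  qed
  moreover have "negative_set \<nu> (D - ?X)"
    unfolding negative_set_def
  proof (intro ballI impI)
    fix F assume F: "F \<in> bounded_borel" "F \<subseteq> D - ?X"
    let ?B = "\<lambda>n. F \<inter> (A n - A (Suc n))"
    have "(\<Union>n. ?B n) = F \<inter> (A 0 - ?X)" using dec(3) by (metis Int_UN_distrib)
    then have un: "(\<Union>n. ?B n) = F" using F(2) A0 by (simp only: Int_absorb2)
    have B: "?B n \<in> bounded_borel" for n
      using F(1) P by (simp add: bounded_borel_Int bounded_borel_Diff)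
    have "disjoint_family ?B"
      using dec(4) unfolding disjoint_family_on_def by blast
    then have "(\<lambda>n. \<nu> (?B n)) sums \<nu> F"
      using signed_sums[OF sm, of ?B, OF B] un F(1) by (simp only: bounded_borel_def mem_Collect_eq)
    moreover have "\<nu> (?B n) \<le> 0" for n
      using Q[of n] B[of n] unfolding negative_set_def by (meson Int_lower2)
    ultimately show "\<nu> F \<le> 0"
      by (rule sums_le[OF _ _ sums_zero, rotated])
  qed
  moreover have "D - (D - ?X) = ?X" using A0 by blast
  ultimately show ?thesis
    using dec(2) D bounded_borel_Diff[of D ?X] by (intro bexI[of _ "D - ?X"]) auto
qed

lemma hahn_decomposition_exists: "\<exists>W. hahn_decomposition \<nu> (- W) W"
proof -
  define C where "C n = {x::real. real n \<le> \<bar>x\<bar> \<and> \<bar>x\<bar> < real n + 1}" for n :: nat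
  have C: "C n \<in> bounded_borel" for n
    unfolding bounded_borel_def
  proof safe
    show "C n \<in> sets borel" unfolding C_def by measurable
    have "C n \<subseteq> cball 0 (real n + 1)" unfolding C_def by auto
    then show "bounded (C n)" using bounded_subset bounded_cball by blast
  qed
  have C_disj: "x \<in> C m \<Longrightarrow> x \<in> C n \<Longrightarrow> m = n" for x m n
    unfolding C_def by auto
  have C_un: "\<exists>n. x \<in> C n" for x
  proof -
    have "real (nat \<lfloor>\<bar>x\<bar>\<rfloor>) \<le> \<bar>x\<bar>" "\<bar>x\<bar> < real (nat \<lfloor>\<bar>x\<bar>\<rfloor>) + 1"
      by linarith+
    then show ?thesis unfolding C_def by blast
  qed
  obtain N where N: "\<And>n. N n \<in> bounded_borel" "\<And>n. N n \<subseteq> C n"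
    "\<And>n. negative_set \<nu> (N n)" "\<And>n. positive_set \<nu> (C n - N n)"
    using hahn_bounded[OF C] by metis
  let ?W = "\<Union>n. N n"
  have sums: "(\<lambda>n. \<nu> (F \<inter> C n)) sums \<nu> F" if F: "F \<in> bounded_borel" for F
  proof -
    have "disjoint_family (\<lambda>n. F \<inter> C n)"
      using C_disj unfolding disjoint_family_on_def by blast
    moreover have "F \<inter> C n \<in> bounded_borel" for n
      using F C by (rule bounded_borel_Int)
    moreover have "(\<Union>n. F \<inter> C n) = F" using C_un by blast
    ultimately show ?thesis
      using signed_sums[OF sm, of "\<lambda>n. F \<inter> C n"] F by (auto simp: bounded_borel_def)
  qed
  have FC: "F \<inter> C n \<in> bounded_borel" if "F \<in> bounded_borel" for F n
    using that C by (rule bounded_borel_Int)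
  have "negative_set \<nu> ?W"
    unfolding negative_set_def
  proof (intro ballI impI)
    fix F assume F: "F \<in> bounded_borel" "F \<subseteq> ?W"
    have "F \<inter> C n \<subseteq> N n" for n
      using F(2) N(2) C_disj by blast
    then have "\<nu> (F \<inter> C n) \<le> 0" for n
      using N(3)[of n] FC[OF F(1)] unfolding negative_set_def by blast
    then show "\<nu> F \<le> 0"
      using sums_le[OF _ sums[OF F(1)] sums_zero] by blast
  qed
  moreover have "positive_set \<nu> (- ?W)"
    unfolding positive_set_def
  proof (intro ballI impI)
    fix F assume F: "F \<in> bounded_borel" "F \<subseteq> - ?W"
    have "F \<inter> C n \<subseteq> C n - N n" for n
      using F(2) by blast
    then have "0 \<le> \<nu> (F \<inter> C n)" for n
      using N(4)[of n] FC[OF F(1)] unfolding positive_set_def by blast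
    then show "0 \<le> \<nu> F"
      using sums_le[OF _ sums_zero sums[OF F(1)]] by blast
  qed
  moreover have "?W \<in> sets borel"
    using N(1) by (auto simp: bounded_borel_def)
  ultimately show ?thesis
    unfolding hahn_decomposition_def by (intro exI[of _ ?W]) (simp add: borel_comp del: Compl_UN)
qed

end

text \<open>
  The Jordan parts do not depend, as functions of bounded Borel sets, on the Hahn
  decomposition chosen.  The negative part is a nonpositive measure.
\<close>

definition hahn_negative_set :: "(real set \<Rightarrow> real) \<Rightarrow> real set" where
  "hahn_negative_set \<nu> = (SOME W. hahn_decomposition \<nu> (- W) W)"

definition pos_part_measure :: "(real set \<Rightarrow> real) \<Rightarrow> real set \<Rightarrow> real" where
  "pos_part_measure \<nu> E = \<nu> (E \<inter> - hahn_negative_set \<nu>)"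

definition neg_part_measure :: "(real set \<Rightarrow> real) \<Rightarrow> real set \<Rightarrow> real" where
  "neg_part_measure \<nu> E = \<nu> (E \<inter> hahn_negative_set \<nu>)"

definition topological_support :: "(real set \<Rightarrow> real) \<Rightarrow> real set" where
  "topological_support \<nu> =
     {x. \<forall>U. open U \<longrightarrow> x \<in> U \<longrightarrow> (\<exists>E \<in> bounded_borel. E \<subseteq> U \<and> \<nu> E \<noteq> 0)}"

definition discrete_measure :: "(real set \<Rightarrow> real) \<Rightarrow> bool" where
  "discrete_measure \<nu> \<longleftrightarrow> (\<forall>a b. finite (topological_support \<nu> \<inter> {a..b}))"


section \<open>Integration with respect to a signed Borel measure\<close>

text \<open>
  The measure in the sense of the library, on all Borel sets and with values in
  \<open>[0,\<infinity>]\<close>, given by a nonnegative set function on the bounded Borel sets.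
\<close>

definition borel_extension :: "(real set \<Rightarrow> real) \<Rightarrow> real measure" where
  "borel_extension \<mu> =
     measure_of UNIV (sets borel) (\<lambda>E. SUP n::nat. ennreal (\<mu> (E \<inter> {- real n..real n})))"

definition signed_locally_integrable :: "(real set \<Rightarrow> real) \<Rightarrow> (real \<Rightarrow> complex) \<Rightarrow> bool" where
  "signed_locally_integrable \<nu> g \<longleftrightarrow>
     (\<forall>a b. set_integrable (borel_extension (pos_part_measure \<nu>)) {a..b} g \<and>
            set_integrable (borel_extension (\<lambda>E. - neg_part_measure \<nu> E)) {a..b} g)"

definition signed_integral :: "(real set \<Rightarrow> real) \<Rightarrow> real set \<Rightarrow> (real \<Rightarrow> complex) \<Rightarrow> complex" where
  "signed_integral \<nu> E g =
     (LINT x:E|borel_extension (pos_part_measure \<nu>). g x) -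
     (LINT x:E|borel_extension (\<lambda>E. - neg_part_measure \<nu> E). g x)"


section \<open>Functions of locally bounded variation and their Borel measures\<close>

definition locally_bounded_variation :: "(real \<Rightarrow> complex) \<Rightarrow> bool" where
  "locally_bounded_variation f \<longleftrightarrow>
     (\<forall>a b. \<exists>K. \<forall>(n::nat) t. mono t \<longrightarrow> range t \<subseteq> {a..b} \<longrightarrow>
        (\<Sum>i<n. norm (f (t (Suc i)) - f (t i))) \<le> K)"

text \<open>
  \<open>m\<close> is the complex Borel measure \<open>df\<close>.  No one-sided continuity of \<open>f\<close> is assumed,
  so half-open intervals are measured by left limits.
\<close>

definition is_borel_measure_of :: "(real \<Rightarrow> complex) \<Rightarrow> (real set \<Rightarrow> complex) \<Rightarrow> bool" where
  "is_borel_measure_of f m \<longleftrightarrow>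
     signed_borel_measure (\<lambda>E. Re (m E)) \<and> signed_borel_measure (\<lambda>E. Im (m E)) \<and>
     (\<forall>a b. a < b \<longrightarrow> m {a..<b} = Lim (at_left b) f - Lim (at_left a) f)"

definition signed_null_set :: "(real set \<Rightarrow> real) \<Rightarrow> real set \<Rightarrow> bool" where
  "signed_null_set \<nu> E \<longleftrightarrow> (\<forall>F \<in> bounded_borel. F \<subseteq> E \<longrightarrow> \<nu> F = 0)"

definition AC_loc_wrt :: "(real set \<Rightarrow> real) \<Rightarrow> (real \<Rightarrow> complex) set" where
  "AC_loc_wrt P =
     {f. locally_bounded_variation f \<and>
         (\<exists>m. is_borel_measure_of f m \<and>
              (\<forall>E \<in> bounded_borel. signed_null_set P E \<longrightarrow> m E = 0))}"

text \<open>\<open>g\<close> is (a representative of) the quasi-derivative of \<open>f\<close>: \<open>df = g dP\<close>.\<close>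

definition is_quasi_derivative ::
    "(real set \<Rightarrow> real) \<Rightarrow> (real \<Rightarrow> complex) \<Rightarrow> (real \<Rightarrow> complex) \<Rightarrow> bool" where
  "is_quasi_derivative P f g \<longleftrightarrow>
     signed_locally_integrable P g \<and>
     (\<exists>m. is_borel_measure_of f m \<and> (\<forall>E \<in> bounded_borel. m E = signed_integral P E g))"

definition AC_loc :: "(real \<Rightarrow> complex) set" where
  "AC_loc =
     {u. \<forall>a b. \<forall>\<epsilon>>0. \<exists>\<delta>>0. \<forall>(n::nat) s t.
           (\<forall>i<n. a \<le> s i \<and> s i \<le> t i \<and> t i \<le> b) \<longrightarrow>
           disjoint_family_on (\<lambda>i. {s i<..<t i}) {..<n} \<longrightarrow>
           (\<Sum>i<n. t i - s i) < \<delta> \<longrightarrow>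
           (\<Sum>i<n. norm (u (t i) - u (s i))) < \<epsilon>}"


section \<open>The operator\<close>

definition L2 :: "(real \<Rightarrow> complex) set" where
  "L2 = {f. f \<in> borel_measurable lebesgue \<and> integrable lebesgue (\<lambda>x. (norm (f x))\<^sup>2)}"

definition L2_inner :: "(real \<Rightarrow> complex) \<Rightarrow> (real \<Rightarrow> complex) \<Rightarrow> complex" where
  "L2_inner f g = (LINT x|lebesgue. f x * cnj (g x))"

text \<open>
  Operators in \<open>L\<^sup>2(\<real>)\<close> are given by their graphs, elements of \<open>L\<^sup>2(\<real>)\<close> by
  representatives.  The quasi-derivative is determined only up to a \<open>|dP|\<close>-null set, and
  the condition on it in the domain asks for a locally absolutely continuous
  representative.  The derivative of the latter exists Lebesgue-almost everywhere.
\<close>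

definition H_graph :: "(real set \<Rightarrow> real) \<Rightarrow> ((real \<Rightarrow> complex) \<times> (real \<Rightarrow> complex)) set" where
  "H_graph P =
     {(f, \<lambda>x. - vector_derivative u (at x)) | f u.
        f \<in> L2 \<and> f \<in> AC_loc_wrt P \<and> is_quasi_derivative P f u \<and>
        u \<in> AC_loc \<and> (\<lambda>x. vector_derivative u (at x)) \<in> L2}"

text \<open>
  The quadratic form of a self-adjoint operator is real; taking the real part only serves
  to express the inequality.
\<close>

definition lower_semibounded :: "((real \<Rightarrow> complex) \<times> (real \<Rightarrow> complex)) set \<Rightarrow> bool" where
  "lower_semibounded T \<longleftrightarrow>
     (\<exists>c::real. \<forall>(f, h) \<in> T. c * Re (L2_inner f f) \<le> Re (L2_inner h f))"

text \<open>The measure \<open>dP = dx + d\<nu>\<close>.\<close>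

definition lebesgue_plus :: "(real set \<Rightarrow> real) \<Rightarrow> real set \<Rightarrow> real" where
  "lebesgue_plus \<nu> E = measure lborel E + \<nu> E"

end

theory Submission
  imports Defs
begin

text \<open>
  For \<open>u\<close> continuously differentiable with compact support and \<open>\<integral> u dP = 0\<close>, the
  function \<open>f(x) = \<integral>\<^bsub>y < x\<^esub> u(y) dP(y)\<close> belongs to the domain of \<open>H\<close>, has
  quasi-derivative \<open>u\<close>, and Fubini's theorem gives \<open>\<langle>H f, f\<rangle> = \<integral> u\<^sup>2 dP\<close>.  Near a point of
  the support of the negative part of \<open>\<nu>\<close> there is a compact Lebesgue-null set on which
  \<open>dP\<close> is purely negative, and approximating its indicator function yields a bump \<open>\<psi>\<close>
  with \<open>\<integral> \<psi> dP = 1\<close>, \<open>\<integral> |\<psi>| |dP| \<le> 2\<close> and \<open>\<integral> \<psi>\<^sup>2 dP \<le> - 1 / (3 B)\<close>, where \<open>B\<close> bounds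
  the negative mass of \<open>dP\<close> on a fixed bounded interval.  If the support has infinitely
  many points there, two of them are arbitrarily close to each other; the difference \<open>u\<close>
  of bumps at these two points gives \<open>\<langle>H f, f\<rangle> \<le> - 2 / (3 B)\<close>, while \<open>f\<close> is bounded by 4
  and supported in an arbitrarily short interval.
\<close>

section \<open>Locally finite Borel measures and the Jordan parts\<close>

lemma bounded_subset_symmetric_interval:
  fixes E :: "real set"
  assumes "bounded E"
  obtains n :: nat where "E \<subseteq> {- real n..real n}"
proof -
  obtain b where b: "\<And>x. x \<in> E \<Longrightarrow> norm x \<le> b"
    using assms bounded_iff by blast
  obtain n :: nat where "b \<le> real n"
    using real_arch_simple by blast
  then have "E \<subseteq> {- real n..real n}"
    using b by (force simp: abs_le_iff)
  then show thesis by (rule that)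
qed

text \<open>Lebesgue measure and both Jordan parts of dP are instances, so primitives and bumps can
  be treated for one such measure at a time. The sigma-finiteness derived below is what Fubini's
  theorem requires.\<close>

locale locally_finite_borel_measure =
  fixes M :: "real measure"
  assumes sets_eq [measurable_cong, simp]: "sets M = sets borel"
    and finite_interval: "emeasure M {a..b} < \<infinity>"
begin

lemma space_eq [simp]: "space M = UNIV"
  using sets_eq_imp_space_eq[OF sets_eq] by simp

lemma finite_bounded:
  assumes "bounded E" shows "emeasure M E < \<infinity>"
proof (rule bounded_subset_symmetric_interval[OF assms])
  fix n :: nat assume "E \<subseteq> {- real n..real n}"
  then have "emeasure M E \<le> emeasure M {- real n..real n}"
    by (intro emeasure_mono) auto
  then show ?thesis using finite_interval le_less_trans by blast
qed

sublocale sigma_finite_measure M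
proof
  let ?A = "range (\<lambda>n::nat. {- real n..real n})"
  have "\<Union>?A = UNIV"
    using bounded_subset_symmetric_interval[of "{x}" for x] 
    by (simp add: set_eq_iff)
      (metis atLeastAtMost_iff bounded_insert bounded_empty insert_subset)
  moreover have "emeasure M {- real n..real n} \<noteq> \<infinity>" for n :: nat
    using finite_interval less_irrefl by metis
  ultimately show "\<exists>A. countable A \<and> A \<subseteq> sets M \<and> \<Union>A = space M \<and> (\<forall>a\<in>A. emeasure M a \<noteq> \<infinity>)"
    by (intro exI[of _ ?A]) auto
qed

end

section \<open>Operations on signed measures\<close>

lemma bounded_borel_Int_borel: "E \<in> bounded_borel \<Longrightarrow> W \<in> sets borel \<Longrightarrow> E \<inter> W \<in> bounded_borel"
  by (rule bounded_borel_subset) (auto simp: bounded_borel_def)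

lemma signed_borel_measure_restrict:
  assumes "signed_borel_measure \<nu>" "W \<in> sets borel"
  shows "signed_borel_measure (\<lambda>E. \<nu> (E \<inter> W))"
  unfolding signed_borel_measure_def
proof (intro allI impI)
  fix A :: "nat \<Rightarrow> real set"
  assume A: "range A \<subseteq> bounded_borel" "disjoint_family A" "bounded (\<Union>n. A n)"
  have "(\<lambda>n. \<nu> (A n \<inter> W)) sums \<nu> (\<Union>n. A n \<inter> W)"
  proof (rule signed_sums[OF assms(1)])
    show "A n \<inter> W \<in> bounded_borel" for n
      using A(1) assms(2) bounded_subset[of "A n" "A n \<inter> W"] by (auto simp: bounded_borel_def)
    show "disjoint_family (\<lambda>n. A n \<inter> W)"
      using A(2) by (auto simp: disjoint_family_on_def)
    show "bounded (\<Union>n. A n \<inter> W)"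
      using A(3) by (rule bounded_subset) auto
  qed
  then show "(\<lambda>n. \<nu> (A n \<inter> W)) sums \<nu> ((\<Union>n. A n) \<inter> W)"
    by (simp add: Int_UN_distrib2)
qed

lemma signed_borel_measure_uminus:
  "signed_borel_measure \<nu> \<Longrightarrow> signed_borel_measure (\<lambda>E. - \<nu> E)"
  unfolding signed_borel_measure_def using sums_minus by blast

lemma signed_borel_measure_add:
  "signed_borel_measure \<mu> \<Longrightarrow> signed_borel_measure \<nu> \<Longrightarrow> signed_borel_measure (\<lambda>E. \<mu> E + \<nu> E)"
  unfolding signed_borel_measure_def using sums_add by blast

lemma signed_borel_measure_diff:
  "signed_borel_measure \<mu> \<Longrightarrow> signed_borel_measure \<nu> \<Longrightarrow> signed_borel_measure (\<lambda>E. \<mu> E - \<nu> E)"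
  unfolding signed_borel_measure_def using sums_diff by blast

lemma (in locally_finite_borel_measure) signed_borel_measure_measure:
  "signed_borel_measure (measure M)"
  unfolding signed_borel_measure_def
proof (intro allI impI)
  fix A :: "nat \<Rightarrow> real set"
  assume A: "range A \<subseteq> bounded_borel" "disjoint_family A" "bounded (\<Union>n. A n)"
  show "(\<lambda>n. measure M (A n)) sums measure M (\<Union>n. A n)"
    using A finite_bounded[OF A(3)] by (intro measure_UNION) (auto simp: bounded_borel_def)
qed

interpretation lborel: locally_finite_borel_measure lborel
  by unfold_locales (auto simp: emeasure_lborel_Icc_eq)

lemma signed_borel_measure_lebesgue_plus:
  "signed_borel_measure \<nu> \<Longrightarrow> signed_borel_measure (lebesgue_plus \<nu>)"
  unfolding lebesgue_plus_def[abs_def]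
  by (intro signed_borel_measure_add lborel.signed_borel_measure_measure)

lemma signed_mono:
  assumes "signed_borel_measure \<mu>" "\<And>E. E \<in> bounded_borel \<Longrightarrow> 0 \<le> \<mu> E"
    "A \<in> bounded_borel" "B \<in> bounded_borel" "A \<subseteq> B"
  shows "\<mu> A \<le> \<mu> B"
  using signed_Diff[OF assms(1,4,3,5)] assms(2)[OF bounded_borel_Diff[OF assms(4,3)]] by simp

section \<open>Extension of a nonnegative set function to a Borel measure\<close>

context
  fixes \<mu> :: "real set \<Rightarrow> real"
  assumes signed: "signed_borel_measure \<mu>"
    and nonneg: "\<And>E. E \<in> bounded_borel \<Longrightarrow> 0 \<le> \<mu> E"
begin

text \<open>For fixed n the truncated sets are bounded and disjoint, so additivity is that of
  \<open>\<mu>\<close>. Each term grows with n by monotonicity, which permits exchanging the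
  supremum over n with the sum over i.\<close>

lemma borel_extension_measure_space:
  "measure_space UNIV (sets borel) (\<lambda>E. SUP n::nat. ennreal (\<mu> (E \<inter> {- real n..real n})))"
  unfolding measure_space_def
proof (intro conjI)
  show "sigma_algebra UNIV (sets (borel :: real measure))"
    using sets.sigma_algebra_axioms[of "borel :: real measure"] by simp
  show "positive (sets borel) (\<lambda>E. SUP n::nat. ennreal (\<mu> (E \<inter> {- real n..real n})))"
    by (simp add: positive_def signed_empty[OF signed])
  show "countably_additive (sets borel) (\<lambda>E. SUP n::nat. ennreal (\<mu> (E \<inter> {- real n..real n})))"
    unfolding countably_additive_def
  proof (intro allI impI)
    fix A :: "nat \<Rightarrow> real set"
    assume A: "range A \<subseteq> sets borel" "disjoint_family A"
    have bb: "A i \<inter> {- real n..real n} \<in> bounded_borel" for i n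
      using A(1) bounded_subset[OF bounded_closed_interval] by (auto simp: bounded_borel_def)
    have "(\<Sum>i. SUP n::nat. ennreal (\<mu> (A i \<inter> {- real n..real n}))) =
        (SUP n::nat. \<Sum>i. ennreal (\<mu> (A i \<inter> {- real n..real n})))"
    proof (rule ennreal_suminf_SUP_eq)
      fix i
      show "incseq (\<lambda>n. ennreal (\<mu> (A i \<inter> {- real n..real n})))"
        by (intro incseq_SucI ennreal_leI signed_mono[OF signed nonneg bb bb]) auto
    qed
    also have "\<dots> = (SUP n::nat. ennreal (\<mu> ((\<Union>i. A i) \<inter> {- real n..real n})))"
    proof (rule SUP_cong)
      fix n :: nat
      have "(\<lambda>i. \<mu> (A i \<inter> {- real n..real n})) sums \<mu> (\<Union>i. A i \<inter> {- real n..real n})"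
      proof (rule signed_sums[OF signed bb])
        show "disjoint_family (\<lambda>i. A i \<inter> {- real n..real n})"
          using A(2) by (auto simp: disjoint_family_on_def)
        show "bounded (\<Union>i. A i \<inter> {- real n..real n})"
          by (rule bounded_subset[OF bounded_closed_interval]) auto
      qed
      then show "(\<Sum>i. ennreal (\<mu> (A i \<inter> {- real n..real n}))) =
          ennreal (\<mu> ((\<Union>i. A i) \<inter> {- real n..real n}))"
        using nonneg[OF bb] by (subst suminf_ennreal_eq) (auto simp: Int_UN_distrib2)
    qed simp
    finally show "(\<Sum>i. SUP n::nat. ennreal (\<mu> (A i \<inter> {- real n..real n}))) =
        (SUP n::nat. ennreal (\<mu> ((\<Union> (range A)) \<inter> {- real n..real n})))" .
  qed
qed

lemma sets_borel_extension: "sets (borel_extension \<mu>) = sets borel"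
  unfolding borel_extension_def using sets.sigma_sets_eq[of "borel :: real measure"]
  by (simp add: sets_measure_of)

text \<open>On a bounded set the supremum in \<open>borel_extension\<close> is attained as soon as
  the interval contains the set, so the extension really extends \<open>\<mu>\<close>.\<close>

lemma emeasure_borel_extension:
  assumes "E \<in> bounded_borel"
  shows "emeasure (borel_extension \<mu>) E = ennreal (\<mu> E)"
proof -
  have E: "E \<in> sets borel" "bounded E"
    using assms by (auto simp: bounded_borel_def)
  have "emeasure (borel_extension \<mu>) E = (SUP n::nat. ennreal (\<mu> (E \<inter> {- real n..real n})))"
    unfolding borel_extension_def
    using borel_extension_measure_space E(1)
    by (intro emeasure_measure_of_sigma) (simp_all add: measure_space_def)
  also have "\<dots> = ennreal (\<mu> E)"
  proof (rule antisym)
    obtain n :: nat where n: "E \<subseteq> {- real n..real n}"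
      using bounded_subset_symmetric_interval E(2) .
    then have "E = E \<inter> {- real n..real n}" by blast
    then show "ennreal (\<mu> E) \<le> (SUP n::nat. ennreal (\<mu> (E \<inter> {- real n..real n})))"
      using SUP_upper[of n UNIV "\<lambda>n::nat. ennreal (\<mu> (E \<inter> {- real n..real n}))"] by simp
    show "(SUP n::nat. ennreal (\<mu> (E \<inter> {- real n..real n}))) \<le> ennreal (\<mu> E)"
      using assms E(1) by (intro SUP_least ennreal_leI signed_mono[OF signed nonneg bounded_borel_subset]) auto
  qed
  finally show ?thesis .
qed

lemma locally_finite_borel_extension: "locally_finite_borel_measure (borel_extension \<mu>)"
proof
  fix a b :: real
  have "{a..b} \<in> bounded_borel" by (simp add: bounded_borel_def)
  then show "emeasure (borel_extension \<mu>) {a..b} < \<infinity>"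
    by (simp add: emeasure_borel_extension)
qed (rule sets_borel_extension)

end

section \<open>The two Jordan parts as Borel measures\<close>

abbreviation "pos_measure \<nu> \<equiv> borel_extension (pos_part_measure \<nu>)"
abbreviation "neg_measure \<nu> \<equiv> borel_extension (\<lambda>E. - neg_part_measure \<nu> E)"

context
  fixes \<nu> :: "real set \<Rightarrow> real"
  assumes sm: "signed_borel_measure \<nu>"
begin

lemma hahn_decomposition_negative_set:
  "hahn_decomposition \<nu> (- hahn_negative_set \<nu>) (hahn_negative_set \<nu>)"
  unfolding hahn_negative_set_def using hahn_decomposition_exists[OF sm] by (rule someI_ex)

lemma hahn_negative_set_borel: "hahn_negative_set \<nu> \<in> sets borel"
  using hahn_decomposition_negative_set by (simp add: hahn_decomposition_def)

lemma pos_part_nonneg: "E \<in> bounded_borel \<Longrightarrow> 0 \<le> pos_part_measure \<nu> E"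
  using hahn_decomposition_negative_set hahn_negative_set_borel
  by (simp add: hahn_decomposition_def positive_set_def pos_part_measure_def bounded_borel_Int_borel)

lemma neg_part_nonpos: "E \<in> bounded_borel \<Longrightarrow> neg_part_measure \<nu> E \<le> 0"
  using hahn_decomposition_negative_set hahn_negative_set_borel
  by (simp add: hahn_decomposition_def negative_set_def neg_part_measure_def bounded_borel_Int_borel)

lemma signed_pos_part: "signed_borel_measure (pos_part_measure \<nu>)"
  unfolding pos_part_measure_def[abs_def]
  using signed_borel_measure_restrict[OF sm, of "- hahn_negative_set \<nu>"] hahn_negative_set_borel by auto

lemma signed_neg_part: "signed_borel_measure (\<lambda>E. - neg_part_measure \<nu> E)"
  unfolding neg_part_measure_def[abs_def]
  using signed_borel_measure_uminus[OF signed_borel_measure_restrict[OF sm hahn_negative_set_borel]] .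

lemma locally_finite_pos_measure: "locally_finite_borel_measure (pos_measure \<nu>)"
  using locally_finite_borel_extension[OF signed_pos_part pos_part_nonneg] .

lemma locally_finite_neg_measure: "locally_finite_borel_measure (neg_measure \<nu>)"
  using locally_finite_borel_extension[OF signed_neg_part] neg_part_nonpos by simp

lemma emeasure_pos_measure:
  "E \<in> bounded_borel \<Longrightarrow> emeasure (pos_measure \<nu>) E = ennreal (\<nu> (E - hahn_negative_set \<nu>))"
  using emeasure_borel_extension[OF signed_pos_part pos_part_nonneg]
  by (simp add: pos_part_measure_def[abs_def] Diff_eq)

lemma emeasure_neg_measure:
  "E \<in> bounded_borel \<Longrightarrow> emeasure (neg_measure \<nu>) E = ennreal (- \<nu> (E \<inter> hahn_negative_set \<nu>))"
  using emeasure_borel_extension[OF signed_neg_part] neg_part_nonpos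
  by (simp add: neg_part_measure_def[abs_def])

end

section \<open>Primitives with respect to a measure\<close>

lemma has_real_derivative_imp_continuous_on_UNIV:
  assumes "\<And>x. (u has_real_derivative u' x) (at x)"
  shows "continuous_on UNIV u"
  using assms DERIV_isCont by (simp add: continuous_on_eq_continuous_at) blast

text \<open>The open end at x makes the primitive left-continuous, which matches the left limits
  used in \<open>is_borel_measure_of\<close>: an atom of \<open>M\<close> at x is counted only to
  the right of x.\<close>

definition primitive_wrt :: "real measure \<Rightarrow> (real \<Rightarrow> real) \<Rightarrow> real \<Rightarrow> real" where
  "primitive_wrt M u x = (LINT y:{..<x}|M. u y)"

context locally_finite_borel_measure
begin

context
  fixes u :: "real \<Rightarrow> real" and \<alpha> \<beta> :: real
  assumes cont: "continuous_on UNIV u" and supp: "\<forall>x. x \<notin> {\<alpha>..\<beta>} \<longrightarrow> u x = 0"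
begin

lemma bounded_compact_support: "\<exists>B. \<forall>x. \<bar>u x\<bar> \<le> B"
proof -
  have "compact (u ` {\<alpha>..\<beta>})"
    by (intro compact_continuous_image continuous_on_subset[OF cont]) auto
  then have "bounded (u ` {\<alpha>..\<beta>})"
    by (rule compact_imp_bounded)
  then obtain B where B: "\<And>x. x \<in> {\<alpha>..\<beta>} \<Longrightarrow> \<bar>u x\<bar> \<le> B"
    unfolding bounded_iff real_norm_def ball_simps by metis
  have "\<bar>u x\<bar> \<le> max B 0" for x
    using B[of x] supp by (cases "x \<in> {\<alpha>..\<beta>}") auto
  then show ?thesis by blast
qed

lemma integrable_compact_support: "integrable M u"
proof -
  have [measurable]: "u \<in> borel_measurable borel"
    using cont by (rule borel_measurable_continuous_onI)
  obtain B where "\<And>x. \<bar>u x\<bar> \<le> B"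
    using bounded_compact_support by blast
  then show ?thesis
    using finite_interval supp by (intro integrableI_bounded_set[of "{\<alpha>..\<beta>}" M u B]) auto
qed

lemma set_integrable_compact_support:
  "E \<in> sets borel \<Longrightarrow> set_integrable M E u"
  unfolding set_integrable_def
  using integrable_compact_support by (intro integrable_mult_indicator) auto

text \<open>Dominated convergence with majorant |u|: partial sums of the indicators of disjoint sets
  are indicators of finite unions, hence at most 1.\<close>

lemma signed_borel_measure_set_integral: "signed_borel_measure (\<lambda>E. LINT x:E|M. u x)"
  unfolding signed_borel_measure_def
proof (intro allI impI)
  have [measurable]: "u \<in> borel_measurable borel"
    using cont by (rule borel_measurable_continuous_onI)
  fix A :: "nat \<Rightarrow> real set"
  assume "range A \<subseteq> bounded_borel" and disj: "disjoint_family A"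
  then have [measurable]: "\<And>n. A n \<in> sets borel"
    by (auto simp: bounded_borel_def)
  have ind: "(\<lambda>n. indicator (A n) x * u x) sums (indicator (\<Union>n. A n) x * u x)" for x
    using disj by (intro sums_mult2 indicator_sums) (auto simp: disjoint_family_on_def)
  have eq: "(\<Sum>i<n. indicator (A i) x) = (indicator (\<Union>i<n. A i) x :: real)" for n x
    using disj by (subst indicator_UN_disjoint) (auto simp: disjoint_family_on_def)
  have "(\<lambda>n. LINT x|M. (\<Sum>i<n. indicator (A i) x * u x)) \<longlonglongrightarrow>
      (LINT x|M. indicator (\<Union>n. A n) x * u x)"
  proof (rule integral_dominated_convergence[where w="\<lambda>x. \<bar>u x\<bar>"])
    show "AE x in M. (\<lambda>n. \<Sum>i<n. indicator (A i) x * u x) \<longlonglongrightarrow> indicator (\<Union>n. A n) x * u x"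
      using ind by (simp add: sums_def)
    show "AE x in M. norm (\<Sum>i<n. indicator (A i) x * u x) \<le> \<bar>u x\<bar>" for n
      unfolding sum_distrib_right[symmetric] eq by (auto simp: abs_mult indicator_def)
    show "integrable M (\<lambda>x. \<bar>u x\<bar>)"
      using integrable_compact_support by simp
  qed measurable
  moreover have "integrable M (\<lambda>x. indicator (A i) x * u x)" for i
    using set_integrable_compact_support[of "A i"] by (simp add: set_integrable_def)
  ultimately show "(\<lambda>n. LINT x:A n|M. u x) sums (LINT x:(\<Union>n. A n)|M. u x)"
    unfolding sums_def set_lebesgue_integral_def real_scaleR_def
    by (simp only: Bochner_Integration.integral_sum)
qed

lemma set_integral_Ico_primitive:
  assumes "a \<le> b"
  shows "(LINT x:{a..<b}|M. u x) = primitive_wrt M u b - primitive_wrt M u a"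
proof -
  have split: "{..<b} = {..<a} \<union> {a..<b}"
    using assms by auto
  have "primitive_wrt M u b = primitive_wrt M u a + (LINT x:{a..<b}|M. u x)"
    unfolding primitive_wrt_def split
    by (intro set_integral_Un set_integrable_compact_support) auto
  then show ?thesis by simp
qed

text \<open>The indicators of \<open>{..<S n}\<close> converge at every point, also at b itself
  because \<open>S n < b\<close>, and dominated convergence applies.\<close>

lemma primitive_left_continuous: "(primitive_wrt M u \<longlongrightarrow> primitive_wrt M u b) (at_left b)"
proof (rule tendsto_at_left_sequentially)
  have [measurable]: "u \<in> borel_measurable borel"
    using cont by (rule borel_measurable_continuous_onI)
  show "b - 1 < b" by simp
  fix S :: "nat \<Rightarrow> real"
  assume S: "\<And>n. S n < b" "S \<longlonglongrightarrow> b"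
  have "(\<lambda>n. LINT y|M. indicator {..<S n} y *\<^sub>R u y) \<longlonglongrightarrow> (LINT y|M. indicator {..<b} y *\<^sub>R u y)"
  proof (rule integral_dominated_convergence[where w="\<lambda>x. \<bar>u x\<bar>"])
    show "integrable M (\<lambda>x. \<bar>u x\<bar>)"
      using integrable_compact_support by simp
    show "AE x in M. (\<lambda>n. indicator {..<S n} x *\<^sub>R u x) \<longlonglongrightarrow> indicator {..<b} x *\<^sub>R u x"
    proof (rule AE_I2)
      fix x
      have "\<forall>\<^sub>F n in sequentially. indicator {..<S n} x *\<^sub>R u x = indicator {..<b} x *\<^sub>R u x"
      proof (cases "x < b")
        case True
        show ?thesis
          using order_tendstoD(1)[OF S(2) True] by eventually_elim (use True in simp)
      next
        case False
        then have "\<not> x < S n" for n using S(1)[of n] by simp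
        then show ?thesis using False by simp
      qed
      then show "(\<lambda>n. indicator {..<S n} x *\<^sub>R u x) \<longlonglongrightarrow> indicator {..<b} x *\<^sub>R u x"
        by (rule tendsto_eventually)
    qed
  qed (auto simp: indicator_def)
  then show "(\<lambda>n. primitive_wrt M u (S n)) \<longlonglongrightarrow> primitive_wrt M u b"
    by (simp add: primitive_wrt_def set_lebesgue_integral_def)
qed

lemma primitive_borel_measurable: "primitive_wrt M u \<in> borel_measurable borel"
proof -
  have [measurable]: "u \<in> borel_measurable borel"
    using cont by (rule borel_measurable_continuous_onI)
  have "(\<lambda>x. LINT y|M. indicator {..<x} y * u y) \<in> borel_measurable borel"
  proof (rule borel_measurable_lebesgue_integral)
    have "(\<lambda>p::real \<times> real. if snd p < fst p then u (snd p) else 0) \<in> borel_measurable (borel \<Otimes>\<^sub>M M)"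
      by measurable
    moreover have "(\<lambda>(x, y). indicator {..<x} y * u y) = (\<lambda>p. if snd p < fst p then u (snd p) else 0)"
      by auto
    ultimately show "(\<lambda>(x, y). indicator {..<x} y * u y) \<in> borel_measurable (borel \<Otimes>\<^sub>M M)"
      by simp
  qed
  then show ?thesis
    by (simp add: primitive_wrt_def[abs_def] set_lebesgue_integral_def)
qed

lemma primitive_abs_le: "\<bar>primitive_wrt M u x\<bar> \<le> (LINT y|M. \<bar>u y\<bar>)"
  unfolding primitive_wrt_def set_lebesgue_integral_def
proof (rule order_trans[OF integral_abs_bound integral_mono_AE])
  show "integrable M (\<lambda>y. \<bar>indicator {..<x} y *\<^sub>R u y\<bar>)"
    using set_integrable_compact_support[of "{..<x}"] unfolding set_integrable_def
    by (intro integrable_abs) simp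
  show "integrable M (\<lambda>y. \<bar>u y\<bar>)"
    using integrable_compact_support by simp
qed (auto simp: indicator_def)

lemma primitive_below: "x \<le> \<alpha> \<Longrightarrow> primitive_wrt M u x = 0"
  unfolding primitive_wrt_def set_lebesgue_integral_def
  using supp by (subst Bochner_Integration.integral_cong[where g="\<lambda>_. 0"]) (auto simp: indicator_def)

text \<open>The strict inequality puts the whole supporting interval, including its right end point,
  into \<open>{..<x}\<close>.\<close>

lemma primitive_above: "\<beta> < x \<Longrightarrow> primitive_wrt M u x = (LINT y|M. u y)"
  unfolding primitive_wrt_def set_lebesgue_integral_def
  using supp by (intro Bochner_Integration.integral_cong) (auto simp: indicator_def)

end

text \<open>The primitive of |u| is a monotone function that controls the increments; summed over a
  partition, its own increments telescope.\<close>

lemma primitive_variation_le: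
  assumes cont: "continuous_on UNIV u" and supp: "\<forall>x. x \<notin> {\<alpha>..\<beta>} \<longrightarrow> u x = 0" and "a \<le> b"
  shows "\<bar>primitive_wrt M u b - primitive_wrt M u a\<bar> \<le>
    primitive_wrt M (\<lambda>x. \<bar>u x\<bar>) b - primitive_wrt M (\<lambda>x. \<bar>u x\<bar>) a"
proof -
  have cont': "continuous_on UNIV (\<lambda>x. \<bar>u x\<bar>)"
    using cont by (intro continuous_intros)
  have supp': "\<forall>x. x \<notin> {\<alpha>..\<beta>} \<longrightarrow> \<bar>u x\<bar> = 0"
    using supp by simp
  have "\<bar>LINT x:{a..<b}|M. u x\<bar> \<le> (LINT x:{a..<b}|M. \<bar>u x\<bar>)"
    using set_integral_norm_bound[OF set_integrable_compact_support[OF cont supp, of "{a..<b}"]] by simp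
  then show ?thesis
    using set_integral_Ico_primitive[OF cont supp assms(3)]
      set_integral_Ico_primitive[OF cont' supp' assms(3)] by simp
qed

context
  fixes u u' :: "real \<Rightarrow> real" and \<alpha> \<beta> :: real
  assumes deriv: "\<And>x. (u has_real_derivative u' x) (at x)"
    and cont': "continuous_on UNIV u'"
    and supp: "\<forall>x. x \<notin> {\<alpha>..\<beta>} \<longrightarrow> u x = 0"
begin

lemma derivative_compact_support:
  "\<forall>x. x \<notin> {\<alpha>..\<beta>} \<longrightarrow> u' x = 0"
proof (intro allI impI)
  fix x assume x: "x \<notin> {\<alpha>..\<beta>}"
  have "open (- {\<alpha>..\<beta>})" by (simp add: open_Compl)
  then have "((\<lambda>_. 0) has_real_derivative u' x) (at x)"
    using x supp by (intro has_field_derivative_transform_within_open[OF deriv]) auto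
  then show "u' x = 0" using DERIV_unique DERIV_const by blast
qed

text \<open>Fubini's theorem turns the double integral of u'(x) u(y) over y < x into the integral in
  y of u(y) times the integral of u' over (y, infinity). The latter is - u(y) because u has compact
  support.\<close>

lemma primitive_integration_by_parts:
  "integrable lborel (\<lambda>x. u' x * primitive_wrt M u x)"
  "(LINT x|lborel. u' x * primitive_wrt M u x) = - (LINT y|M. (u y)\<^sup>2)"
proof -
  note cont = has_real_derivative_imp_continuous_on_UNIV[OF deriv]
  note supp' = derivative_compact_support
  have [measurable]: "u \<in> borel_measurable borel" "u' \<in> borel_measurable borel"
    using cont cont' by (auto intro: borel_measurable_continuous_onI)
  interpret pair: pair_sigma_finite lborel M ..
  let ?g = "\<lambda>x y. u' x * (if y < x then u y else 0)"
  have g: "integrable (lborel \<Otimes>\<^sub>M M) (case_prod ?g)"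
  proof (rule Bochner_Integration.integrable_bound)
    \<comment> \<open>The product u'(x) u(y) dominates the kernel, and its factors are integrable
      separately.\<close>
    show "integrable (lborel \<Otimes>\<^sub>M M) (\<lambda>(x, y). u' x * u y)"
    proof (rule pair.Fubini_integrable)
      have "integrable lborel (\<lambda>x. \<bar>u' x\<bar> * (LINT y|M. \<bar>u y\<bar>))"
        using lborel.integrable_compact_support[OF cont' supp'] by (intro integrable_mult_left integrable_abs)
      then show "integrable lborel (\<lambda>x. LINT y|M. norm (case (x, y) of (x, y) \<Rightarrow> u' x * u y))"
        by (simp add: abs_mult)
      show "AE x in lborel. integrable M (\<lambda>y. case (x, y) of (x, y) \<Rightarrow> u' x * u y)"
        using integrable_compact_support[OF cont supp] by simp
    qed measurable
    have "(\<lambda>p::real \<times> real. u' (fst p) * (if snd p < fst p then u (snd p) else 0))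
        \<in> borel_measurable (lborel \<Otimes>\<^sub>M M)"
      by measurable
    then show "(\<lambda>(x, y). ?g x y) \<in> borel_measurable (lborel \<Otimes>\<^sub>M M)"
      by (simp add: case_prod_beta')
  qed (auto simp: abs_mult)
  have prim: "primitive_wrt M u x = (LINT y|M. (if y < x then u y else 0))" for x
    unfolding primitive_wrt_def set_lebesgue_integral_def
    by (intro Bochner_Integration.integral_cong) (auto simp: indicator_def)
  show "integrable lborel (\<lambda>x. u' x * primitive_wrt M u x)"
    using pair.integrable_fst'[OF g] by (simp add: prim)
  have inner: "(LINT x|lborel. ?g x y) = - (u y)\<^sup>2" for y
  proof -
    \<comment> \<open>A point to the right of both y and the support, so that u vanishes
      there.\<close>
    let ?b = "max y \<beta> + 1"
    have "(LBINT x=y..?b. u' x) = u ?b - u y"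
    proof (rule interval_integral_FTC_finite)
      show "continuous_on {min y ?b..max y ?b} u'"
        using cont' continuous_on_subset by blast
      show "(u has_vector_derivative u' x) (at x within {min y ?b..max y ?b})"
        for x
        using deriv[of x] by (simp add: has_real_derivative_iff_has_vector_derivative has_vector_derivative_at_within)
    qed
    also have "u ?b = 0"
    proof -
      have "\<beta> < ?b" using max.cobounded2[of \<beta> y] by linarith
      then have "?b \<notin> {\<alpha>..\<beta>}" by (simp only: atLeastAtMost_iff not_le) simp
      then show ?thesis using supp by blast
    qed
    also have "(LBINT x=y..?b. u' x) = (LINT x|lborel. indicator {y<..<?b} x * u' x)"
      by (simp add: interval_lebesgue_integral_def set_lebesgue_integral_def einterval_eq)
    also have "\<dots> = (LINT x|lborel. (if y < x then u' x else 0))"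
      by (intro Bochner_Integration.integral_cong) (auto simp: indicator_def intro!: supp'[rule_format])
    finally have *: "(LINT x|lborel. (if y < x then u' x else 0)) = - u y" by simp
    have "(LINT x|lborel. ?g x y) = (LINT x|lborel. (if y < x then u' x else 0) * u y)"
      by (intro Bochner_Integration.integral_cong) auto
    then show ?thesis
      using * by (simp add: power2_eq_square)
  qed
  show "(LINT x|lborel. u' x * primitive_wrt M u x) = - (LINT y|M. (u y)\<^sup>2)"
    using pair.Fubini_integral[OF g] by (simp add: inner prim)
qed

end

end

section \<open>Bump functions near the negative part\<close>

text \<open>Squaring removes the kink of the positive part at 0, where the difference quotient is at
  most |h|. This is the building block of the continuously differentiable plateau functions.\<close>

lemma has_real_derivative_pos_part_power2:
  "((\<lambda>x. (max 0 x)\<^sup>2) has_real_derivative 2 * max 0 x) (at x)" for x :: real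
proof -
  consider "x < 0" | "x = 0" | "0 < x" by linarith
  then show ?thesis
  proof cases
    case 1
    have "((\<lambda>x. 0) has_real_derivative 0) (at x)" by simp
    from has_field_derivative_transform_within_open[OF this, of "{..<0}"] 1 show ?thesis
      by auto
  next
    case 2
    have "((\<lambda>h. (max 0 h)\<^sup>2 / h) \<longlongrightarrow> 0) (at (0::real))"
    proof (rule Lim_null_comparison)
      show "\<forall>\<^sub>F h in at (0::real). norm ((max 0 h)\<^sup>2 / h) \<le> \<bar>h\<bar>"
        by (rule always_eventually) (auto simp: max_def power2_eq_square)
      show "((\<lambda>h::real. \<bar>h\<bar>) \<longlongrightarrow> 0) (at 0)"
        using tendsto_rabs_zero[OF tendsto_ident_at] .
    qed
    then show ?thesis
      using 2 by (simp add: has_field_derivative_iff)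
  next
    case 3
    have "((\<lambda>x. x\<^sup>2) has_real_derivative 2 * x) (at x)"
      by (auto intro!: derivative_eq_intros)
    from has_field_derivative_transform_within_open[OF this, of "{0<..}"] 3 show ?thesis
      by auto
  qed
qed

text \<open>Finitely many balls contained in U cover K. The sum of the squared positive parts of r^2
  - (x - c)^2 over these balls is C1, positive on K and zero outside U. By compactness it has a
  positive lower bound on K, above which it is flattened to 1.\<close>

lemma C1_plateau_function:
  fixes K U :: "real set"
  assumes K: "compact K" and U: "open U" "K \<subseteq> U"
  obtains \<phi> \<phi>' :: "real \<Rightarrow> real"
  where "\<And>x. (\<phi> has_real_derivative \<phi>' x) (at x)" "continuous_on UNIV \<phi>'"
    "\<And>x. 0 \<le> \<phi> x" "\<And>x. \<phi> x \<le> 1" "\<And>x. x \<in> K \<Longrightarrow> \<phi> x = 1" "\<And>x. x \<notin> U \<Longrightarrow> \<phi> x = 0"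
proof -
  have "\<forall>x\<in>K. \<exists>r>0. ball x r \<subseteq> U"
    using U open_contains_ball by blast
  then obtain r where r: "\<And>x. x \<in> K \<Longrightarrow> 0 < r x" "\<And>x. x \<in> K \<Longrightarrow> ball x (r x) \<subseteq> U"
    by metis
  obtain J where J: "J \<subseteq> K" "finite J" "K \<subseteq> (\<Union>c\<in>J. ball c (r c))"
  proof (rule compactE_image[OF K, of K "\<lambda>c. ball c (r c)"])
    show "K \<subseteq> (\<Union>c\<in>K. ball c (r c))"
      using r(1) by force
  qed auto
  let ?q = "\<lambda>c x. (r c)\<^sup>2 - (x - c)\<^sup>2"
  define s where "s x = (\<Sum>c\<in>J. (max 0 (?q c x))\<^sup>2)" for x
  define s' where "s' x = (\<Sum>c\<in>J. 2 * max 0 (?q c x) * (- 2 * (x - c)))" for x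
  have pos_iff: "0 < ?q c x \<longleftrightarrow> x \<in> ball c (r c)" if "c \<in> J" for c x
  proof -
    have "0 < r c" using that J(1) r(1) by blast
    then have "(x - c)\<^sup>2 < (r c)\<^sup>2 \<longleftrightarrow> \<bar>x - c\<bar> < r c"
      using abs_square_less_1 by (metis abs_of_pos abs_le_square_iff not_le)
    then show ?thesis by (simp add: dist_real_def abs_minus_commute)
  qed
  have s_deriv: "(s has_real_derivative s' x) (at x)" for x
    unfolding s_def[abs_def] s'_def
  proof (rule DERIV_sum)
    fix c
    have "(?q c has_real_derivative - 2 * (x - c)) (at x)"
      by (auto intro!: derivative_eq_intros)
    from DERIV_chain2[OF has_real_derivative_pos_part_power2 this]
    show "((\<lambda>x. (max 0 (?q c x))\<^sup>2) has_real_derivative 2 * max 0 (?q c x) * (- 2 * (x - c))) (at x)" .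
  qed
  have s_cont: "continuous_on A s" for A
    unfolding s_def[abs_def] by (intro continuous_intros)
  have s'_cont: "continuous_on UNIV s'"
    unfolding s'_def[abs_def] by (intro continuous_intros)
  have s_nonneg: "0 \<le> s x" for x
    unfolding s_def by (intro sum_nonneg) auto
  have s_zero: "s x = 0" if "x \<notin> U" for x
    unfolding s_def
  proof (rule sum.neutral, rule ballI)
    fix c assume c: "c \<in> J"
    then have "x \<notin> ball c (r c)" using that J(1) r(2) by blast
    then have "\<not> 0 < ?q c x" using pos_iff[OF c] by blast
    then show "(max 0 (?q c x))\<^sup>2 = 0" by simp
  qed
  have s_pos: "0 < s x" if x: "x \<in> K" for x
  proof -
    obtain c where c: "c \<in> J" "x \<in> ball c (r c)" using x J(3) by blast
    then have "0 < (max 0 (?q c x))\<^sup>2" using pos_iff[OF c(1), of x] by (auto simp: max_def)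
    then show ?thesis
      unfolding s_def by (intro sum_pos2[OF J(2) c(1)]) auto
  qed
  \<comment> \<open>The minimum of s on K; any positive number serves when K is empty.\<close>
  obtain \<delta> where \<delta>: "0 < \<delta>" "\<And>x. x \<in> K \<Longrightarrow> \<delta> \<le> s x"
  proof (cases "K = {}")
    case False
    from continuous_attains_inf[OF K this s_cont] obtain x where "x \<in> K" "\<forall>y\<in>K. s x \<le> s y"
      by blast
    then show ?thesis using s_pos that[of "s x"] by blast
  qed (use that[of 1] in auto)
  show thesis
  proof
    \<comment> \<open>The outer function t -> 1 - (max 0 (1 - t / \<delta>))^2 is C1, sends 0 to 0
      and every t at least \<delta> to 1.\<close>
    show "((\<lambda>x. 1 - (max 0 (1 - s x / \<delta>))\<^sup>2) has_real_derivative
        - (2 * max 0 (1 - s x / \<delta>) * (- s' x / \<delta>))) (at x)" for x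
    proof -
      have "((\<lambda>x. 1 - s x / \<delta>) has_real_derivative - s' x / \<delta>) (at x)"
        using \<delta>(1) by (auto intro!: derivative_eq_intros s_deriv)
      from DERIV_diff[OF DERIV_const DERIV_chain2[OF has_real_derivative_pos_part_power2 this]]
      show ?thesis by simp
    qed
    show "continuous_on UNIV (\<lambda>x. - (2 * max 0 (1 - s x / \<delta>) * (- s' x / \<delta>)))"
      using \<delta>(1) by (intro continuous_intros s_cont s'_cont) auto
    show "0 \<le> 1 - (max 0 (1 - s x / \<delta>))\<^sup>2" for x
    proof -
      have "max 0 (1 - s x / \<delta>) \<le> 1" using s_nonneg[of x] \<delta>(1) by simp
      then show ?thesis by (simp add: power_le_one)
    qed
    show "1 - (max 0 (1 - s x / \<delta>))\<^sup>2 = 1" if "x \<in> K" for x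
      using \<delta>(2)[OF that] \<delta>(1) by (simp add: max_def)
    show "1 - (max 0 (1 - s x / \<delta>))\<^sup>2 = 0" if "x \<notin> U" for x
      using s_zero[OF that] by simp
  qed auto
qed

section \<open>Approximation by compact and open sets\<close>

context locally_finite_borel_measure
begin

text \<open>Inner regularity, applied to the finite measure that \<open>M\<close> induces on an
  interval containing E.\<close>

lemma exists_compact_subset_pos_measure:
  assumes "E \<in> sets borel" "bounded E" "0 < emeasure M E"
  obtains K where "compact K" "K \<subseteq> E" "0 < emeasure M K"
proof -
  obtain n :: nat where n: "E \<subseteq> {- real n..real n}"
    using bounded_subset_symmetric_interval assms(2) .
  let ?I = "{- real n..real n}"
  let ?N = "density M (indicator ?I)"
  have N: "emeasure ?N A = emeasure M (?I \<inter> A)" if "A \<in> sets borel" for A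
    using that by (intro emeasure_restricted) auto
  have "emeasure ?N (space ?N) < \<infinity>"
    using N[of UNIV] finite_interval by simp
  then have "emeasure ?N E = (SUP K \<in> {K. K \<subseteq> E \<and> compact K}. emeasure ?N K)"
    using assms(1) by (intro inner_regular) auto
  moreover have "emeasure ?N E = emeasure M E"
    using N[OF assms(1)] n by (simp add: Int_absorb1)
  ultimately have "0 < (SUP K \<in> {K. K \<subseteq> E \<and> compact K}. emeasure ?N K)"
    using assms(3) by simp
  then obtain K where K: "K \<subseteq> E" "compact K" "0 < emeasure ?N K"
    unfolding less_SUP_iff by blast
  moreover have "emeasure ?N K = emeasure M K"
    using N[of K] K(1) n borel_compact[OF K(2)] by (simp add: Int_absorb1)
  ultimately show thesis using that by simp
qed

text \<open>Outer regularity of the same kind of finite restriction. The open set found is cut down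
  to V, which lies in the interval where the restriction agrees with \<open>M\<close>.\<close>

lemma exists_open_superset_measure_less:
  assumes K: "compact K" and V: "open V" "K \<subseteq> V" "bounded V" and \<epsilon>: "0 < \<epsilon>"
  obtains U where "open U" "K \<subseteq> U" "U \<subseteq> V" "measure M U < measure M K + \<epsilon>"
proof -
  obtain n :: nat where n: "V \<subseteq> {- real n..real n}"
    using bounded_subset_symmetric_interval V(3) .
  let ?I = "{- real n..real n}"
  let ?N = "density M (indicator ?I)"
  have N: "emeasure ?N A = emeasure M (?I \<inter> A)" if "A \<in> sets borel" for A
    using that by (intro emeasure_restricted) auto
  have finK: "emeasure M K < \<infinity>"
    using K compact_imp_bounded by (intro finite_bounded) auto
  have "emeasure ?N (space ?N) < \<infinity>"
    using N[of UNIV] finite_interval by simp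
  then have "emeasure ?N K = (INF U \<in> {U. K \<subseteq> U \<and> open U}. emeasure ?N U)"
    using borel_compact[OF K] by (intro outer_regular) auto
  moreover have "emeasure ?N K = emeasure M K"
    using N[OF borel_compact[OF K]] V(2) n by (simp add: Int_absorb1 subset_trans)
  moreover have "emeasure M K + 0 < emeasure M K + ennreal \<epsilon>"
    using finK \<epsilon> unfolding ennreal_add_left_cancel_less by auto
  ultimately have "(INF U \<in> {U. K \<subseteq> U \<and> open U}. emeasure ?N U) < emeasure M K + ennreal \<epsilon>"
    by (metis add.right_neutral)
  then obtain U where U: "K \<subseteq> U" "open U" "emeasure ?N U < emeasure M K + ennreal \<epsilon>"
    unfolding INF_less_iff by blast
  have "emeasure M (U \<inter> V) \<le> emeasure ?N U"
    using N[of U] U(2) V(1) n by (auto intro!: emeasure_mono)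
  then have "emeasure M (U \<inter> V) < emeasure M K + ennreal \<epsilon>"
    using U(3) by (rule le_less_trans)
  moreover have "emeasure M (U \<inter> V) < \<infinity>"
    using V(3) by (intro finite_bounded) (auto intro: bounded_subset)
  ultimately have "measure M (U \<inter> V) < measure M K + \<epsilon>"
    using finK \<epsilon>
    by (simp add: emeasure_eq_ennreal_measure ennreal_plus[symmetric] ennreal_less_iff del: ennreal_plus)
  then show thesis
    using that[of "U \<inter> V"] U V by auto
qed

text \<open>The function lies between the indicators of K and U. Its square inherits the hypotheses,
  so the bounds serve for both.\<close>

lemma integral_plateau_bounds:
  assumes "compact K" "open U" "K \<subseteq> U" "bounded U"
    and cont: "continuous_on UNIV \<phi>"
    and \<phi>: "\<And>x. 0 \<le> \<phi> x" "\<And>x. \<phi> x \<le> 1" "\<And>x. x \<in> K \<Longrightarrow> \<phi> x = 1" "\<And>x. x \<notin> U \<Longrightarrow> \<phi> x = 0"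
  shows "measure M K \<le> (LINT x|M. \<phi> x)" "(LINT x|M. \<phi> x) \<le> measure M U" "integrable M \<phi>"
proof -
  obtain n :: nat where n: "U \<subseteq> {- real n..real n}"
    using bounded_subset_symmetric_interval assms(4) .
  show int: "integrable M \<phi>"
    using n \<phi>(4) by (intro integrable_compact_support[OF cont, of "- real n" "real n"]) blast
  have fin: "emeasure M K < \<infinity>" "emeasure M U < \<infinity>"
    using finite_bounded[OF compact_imp_bounded[OF assms(1)]] finite_bounded[OF assms(4)] by auto
  have "integrable M (indicator K :: real \<Rightarrow> real)" "integrable M (indicator U :: real \<Rightarrow> real)"
    using fin borel_compact[OF assms(1)] assms(2) by (simp_all add: integrable_indicator_iff)
  note ind = this
  have "(LINT x|M. indicator K x) \<le> (LINT x|M. \<phi> x)"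
    using \<phi> by (intro integral_mono ind int) (auto simp: indicator_def)
  then show "measure M K \<le> (LINT x|M. \<phi> x)"
    using borel_compact[OF assms(1)] by simp
  have "(LINT x|M. \<phi> x) \<le> (LINT x|M. indicator U x)"
    using \<phi> by (intro integral_mono ind int) (auto simp: indicator_def)
  then show "(LINT x|M. \<phi> x) \<le> measure M U"
    using assms(2) by simp
qed

end

text \<open>With m the \<open>Mm\<close>-mass of a compact K inside E, a plateau function close to
  the indicator of K has a signed integral A comparable to - m. Dividing by A normalizes the
  integral; A is negative, but the square does not see the sign. The bound on the squared integral
  is uniform in E because m is at most B.\<close>

lemma exists_normalized_bump:
  assumes "locally_finite_borel_measure Mp" "locally_finite_borel_measure Mm"
    and E: "E \<in> sets borel" "E \<subseteq> {a<..<b}" "emeasure Mp E = 0" "0 < emeasure Mm E"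
    and B: "measure Mm {a..b} \<le> B"
  obtains \<psi> \<psi>' :: "real \<Rightarrow> real"
  where "\<And>x. (\<psi> has_real_derivative \<psi>' x) (at x)" "continuous_on UNIV \<psi>'"
    "\<And>x. x \<notin> {a<..<b} \<Longrightarrow> \<psi> x = 0"
    "(LINT x|Mp. \<psi> x) - (LINT x|Mm. \<psi> x) = 1"
    "(LINT x|Mp. \<bar>\<psi> x\<bar>) + (LINT x|Mm. \<bar>\<psi> x\<bar>) \<le> 2"
    "(LINT x|Mp. (\<psi> x)\<^sup>2) - (LINT x|Mm. (\<psi> x)\<^sup>2) \<le> - 1 / (3 * B)"
proof -
  interpret p: locally_finite_borel_measure Mp by fact
  interpret m: locally_finite_borel_measure Mm by fact
  have bdd: "bounded {a<..<b}" by simp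
  obtain K where K: "compact K" "K \<subseteq> E" "0 < emeasure Mm K"
    using m.exists_compact_subset_pos_measure E bounded_subset[OF bdd E(2)] by metis
  have KV: "K \<subseteq> {a<..<b}" using K(2) E(2) by blast
  define m where "m = measure Mm K"
  have K_fin: "emeasure Mm K < \<infinity>" by (intro m.finite_bounded compact_imp_bounded K)
  then have m: "0 < m"
    using K(3) by (simp add: m_def emeasure_eq_ennreal_measure)
  have "measure Mm K \<le> measure Mm {a..b}"
    using KV m.finite_interval[of a b] borel_compact[OF K(1)]
    by (intro measure_mono_fmeasurable) (auto simp: fmeasurable_def)
  then have mB: "m \<le> B" using B by (simp add: m_def)
  have "emeasure Mp K \<le> emeasure Mp E"
    using K(2) E(1) by (intro emeasure_mono) auto
  then have Kp: "measure Mp K = 0" using E(3) by (simp add: measure_def)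
  have m4: "0 < m / 4" using m by simp
  \<comment> \<open>V makes the \<open>Mp\<close>-mass small, and U inside V then controls the
    \<open>Mm\<close>-mass as well. The error m / 4 determines all constants below.\<close>
  obtain V where V: "open V" "K \<subseteq> V" "V \<subseteq> {a<..<b}" "measure Mp V < measure Mp K + m / 4"
    using p.exists_open_superset_measure_less[OF K(1) open_greaterThanLessThan KV bdd m4] by metis
  have "bounded V" using V(3) bdd bounded_subset by blast
  then obtain U where U: "open U" "K \<subseteq> U" "U \<subseteq> V" "measure Mm U < measure Mm K + m / 4"
    using m.exists_open_superset_measure_less[OF K(1) V(1,2) _ m4] by metis
  have "bounded U" using U(3) \<open>bounded V\<close> bounded_subset by blast
  have "measure Mp U \<le> measure Mp V"
    using U(1,3) V(1) p.finite_bounded[OF \<open>bounded V\<close>]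
    by (intro measure_mono_fmeasurable) (auto simp: fmeasurable_def)
  then have Up: "measure Mp U < m / 4" using V(4) Kp by simp
  have Um: "measure Mm U < 5 * m / 4" using U(4) by (simp add: m_def)
  obtain \<phi> \<phi>' where \<phi>: "\<And>x. (\<phi> has_real_derivative \<phi>' x) (at x)" "continuous_on UNIV \<phi>'"
    "\<And>x. 0 \<le> \<phi> x" "\<And>x. \<phi> x \<le> 1" "\<And>x. x \<in> K \<Longrightarrow> \<phi> x = 1" "\<And>x. x \<notin> U \<Longrightarrow> \<phi> x = 0"
    using C1_plateau_function[OF K(1) U(1,2)] by metis
  note cont = has_real_derivative_imp_continuous_on_UNIV[OF \<phi>(1)]
  have cont2: "continuous_on UNIV (\<lambda>x. (\<phi> x)\<^sup>2)"
    using cont by (intro continuous_intros)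
  have \<phi>2: "(\<phi> x)\<^sup>2 \<le> 1" for x
    using \<phi>(3,4)[of x] by (simp add: power_le_one)
  note pb = p.integral_plateau_bounds[OF K(1) U(1,2) \<open>bounded U\<close> cont \<phi>(3-6)]
  note mb = m.integral_plateau_bounds[OF K(1) U(1,2) \<open>bounded U\<close> cont \<phi>(3-6)]
  have p2: "(LINT x|Mp. (\<phi> x)\<^sup>2) \<le> measure Mp U"
    using p.integral_plateau_bounds(2)[OF K(1) U(1,2) \<open>bounded U\<close> cont2] \<phi>2 \<phi>(3-6) by auto
  have m2: "m \<le> (LINT x|Mm. (\<phi> x)\<^sup>2)"
    unfolding m_def
    using m.integral_plateau_bounds(1)[OF K(1) U(1,2) \<open>bounded U\<close> cont2] \<phi>2 \<phi>(3-6) by auto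
  define A where "A = (LINT x|Mp. \<phi> x) - (LINT x|Mm. \<phi> x)"
  \<comment> \<open>The \<open>Mp\<close>-integral of \<phi> lies between 0 and m / 4, the
    \<open>Mm\<close>-integral between m and 5 m / 4.\<close>
  have A: "- 5 * m / 4 \<le> A" "A \<le> - 3 * m / 4"
    using pb(1,2) mb(1,2) Up Um Kp unfolding A_def m_def[symmetric] by linarith+
  have A0: "A < 0" using A(2) m by simp
  show thesis
  proof
    show "((\<lambda>x. \<phi> x / A) has_real_derivative \<phi>' x / A) (at x)" for x
      using \<phi>(1) by (rule DERIV_cdivide)
    show "continuous_on UNIV (\<lambda>x. \<phi>' x / A)"
      using \<phi>(2) A0 by (intro continuous_intros) auto
    show "\<phi> x / A = 0" if "x \<notin> {a<..<b}" for x
      using that \<phi>(6)[of x] subsetD[OF U(3)] subsetD[OF V(3)] by fastforce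
    show "(LINT x|Mp. \<phi> x / A) - (LINT x|Mm. \<phi> x / A) = 1"
      using A0 by (simp add: A_def flip: diff_divide_distrib)
    have abs: "\<bar>\<phi> x / A\<bar> = \<phi> x / - A" for x
      using A0 \<phi>(3)[of x] by simp
    show "(LINT x|Mp. \<bar>\<phi> x / A\<bar>) + (LINT x|Mm. \<bar>\<phi> x / A\<bar>) \<le> 2"
    proof -
      \<comment> \<open>The masses add up to less than m / 4 + 5 m / 4 = 3 m / 2, twice the lower
        bound 3 m / 4 of - A.\<close>
      have "(LINT x|Mp. \<phi> x) + (LINT x|Mm. \<phi> x) \<le> 2 * (- A)"
        using pb(2) mb(2) Up Um A(2) by linarith
      then have "((LINT x|Mp. \<phi> x) + (LINT x|Mm. \<phi> x)) / (- A) \<le> 2"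
        using A0 by (simp only: pos_divide_le_eq neg_0_less_iff_less)
      then show ?thesis unfolding abs by (simp add: add_divide_distrib)
    qed
    show "(LINT x|Mp. (\<phi> x / A)\<^sup>2) - (LINT x|Mm. (\<phi> x / A)\<^sup>2) \<le> - 1 / (3 * B)"
    proof -
      define D where "D = (LINT x|Mm. (\<phi> x)\<^sup>2) - (LINT x|Mp. (\<phi> x)\<^sup>2)"
      have D: "3 * m / 4 \<le> D" unfolding D_def using p2 m2 Up by linarith
      have "(- A)\<^sup>2 \<le> (5 * m / 4)\<^sup>2"
        using A A0 by (intro power_mono) auto
      then have "A\<^sup>2 \<le> 25 / 16 * (m * m)" by (simp add: power2_eq_square)
      \<comment> \<open>The constant 3 leaves room here, since 25 / 16 < 9 / 4.\<close>
      also have "\<dots> \<le> 3 * B * (3 * m / 4)"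
        using mult_right_mono[OF mB, of m] m by simp
      also have "\<dots> \<le> 3 * B * D"
        using D mB m by (intro mult_left_mono) auto
      finally have "1 / (3 * B) \<le> D / A\<^sup>2"
        using mB m A0 by (simp add: field_simps)
      then show ?thesis
        by (simp add: D_def power_divide diff_divide_distrib)
    qed
  qed
qed

section \<open>The quadratic form of the operator\<close>

lemma set_integral_null_set_eq_0:
  fixes f :: "'a \<Rightarrow> real"
  assumes "E \<in> null_sets M"
  shows "(LINT x:E|M. f x) = 0"
  unfolding set_lebesgue_integral_def
  using AE_not_in[OF assms] by (intro integral_eq_zero_AE) (auto simp: indicator_def elim: AE_mp)

lemma Lim_at_left_real:
  fixes f :: "real \<Rightarrow> 'a::t2_space"
  assumes "(f \<longlongrightarrow> l) (at_left b)" shows "Lim (at_left b) f = l"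
  using tendsto_Lim[OF trivial_limit_at_left_real assms] .

text \<open>By the mean value theorem u is globally Lipschitz, so one choice of delta works on every
  interval.\<close>

lemma bounded_derivative_in_AC_loc:
  fixes u u' :: "real \<Rightarrow> real"
  assumes deriv: "\<And>x. (u has_real_derivative u' x) (at x)" and B: "\<And>x. \<bar>u' x\<bar> \<le> B"
  shows "(\<lambda>x. complex_of_real (u x)) \<in> AC_loc"
  unfolding AC_loc_def mem_Collect_eq
proof (intro allI impI)
  fix a b \<epsilon> :: real
  assume \<epsilon>: "0 < \<epsilon>"
  have B0: "0 \<le> B" using B[of 0] by linarith
  \<comment> \<open>B + 1 rather than B keeps the divisor in the choice of delta positive when B =
    0.\<close>
  have lip: "norm (complex_of_real (u t) - complex_of_real (u s)) \<le> (B + 1) * (t - s)" if "s \<le> t" for s t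
  proof (cases "s = t")
    case False
    then have "s < t" using that by simp
    then obtain z where "u t - u s = (t - s) * u' z"
      using MVT2[of s t u u'] deriv by blast
    then have "\<bar>u t - u s\<bar> = \<bar>u' z\<bar> * (t - s)"
      using that by (simp add: abs_mult)
    also have "\<dots> \<le> (B + 1) * (t - s)"
      using B[of z] that by (intro mult_right_mono) auto
    finally show ?thesis by (metis norm_of_real of_real_diff)
  qed simp
  show "\<exists>\<delta>>0. \<forall>(n::nat) s t. (\<forall>i<n. a \<le> s i \<and> s i \<le> t i \<and> t i \<le> b) \<longrightarrow>
      disjoint_family_on (\<lambda>i. {s i<..<t i}) {..<n} \<longrightarrow> (\<Sum>i<n. t i - s i) < \<delta> \<longrightarrow>
      (\<Sum>i<n. norm (complex_of_real (u (t i)) - complex_of_real (u (s i)))) < \<epsilon>"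
  proof (intro exI[of _ "\<epsilon> / (B + 1)"] conjI allI impI)
    show "0 < \<epsilon> / (B + 1)" using \<epsilon> B0 by simp
    fix n :: nat and s t :: "nat \<Rightarrow> real"
    assume st: "\<forall>i<n. a \<le> s i \<and> s i \<le> t i \<and> t i \<le> b" and small: "(\<Sum>i<n. t i - s i) < \<epsilon> / (B + 1)"
    have "(\<Sum>i<n. norm (complex_of_real (u (t i)) - complex_of_real (u (s i)))) \<le> (\<Sum>i<n. (B + 1) * (t i - s i))"
      using st by (intro sum_mono lip) auto
    also have "\<dots> = (B + 1) * (\<Sum>i<n. t i - s i)"
      by (simp add: sum_distrib_left)
    also have "\<dots> < \<epsilon>"
      using small B0 by (simp add: pos_less_divide_eq mult.commute)
    finally show "(\<Sum>i<n. norm (complex_of_real (u (t i)) - complex_of_real (u (s i)))) < \<epsilon>" .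
  qed
qed

lemma bounded_compact_support_in_L2:
  fixes f :: "real \<Rightarrow> real"
  assumes [measurable]: "f \<in> borel_measurable borel"
    and B: "\<And>x. \<bar>f x\<bar> \<le> B" and supp: "\<forall>x. x \<notin> {\<alpha>..\<beta>} \<longrightarrow> f x = 0"
  shows "integrable lborel (\<lambda>x. (f x)\<^sup>2)" "(\<lambda>x. complex_of_real (f x)) \<in> L2"
proof -
  have "(f x)\<^sup>2 \<le> B\<^sup>2" for x
    using B[of x] by (metis abs_ge_zero power2_abs power_mono)
  then show int: "integrable lborel (\<lambda>x. (f x)\<^sup>2)"
    using supp by (intro integrableI_bounded_set[of "{\<alpha>..\<beta>}" _ _ "B\<^sup>2"]) (simp_all add: emeasure_lborel_Icc_eq)
  have "(\<lambda>x. complex_of_real (f x)) \<in> borel_measurable lebesgue"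
    by (rule measurable_completion) measurable
  moreover have "integrable lebesgue (\<lambda>x. (norm (complex_of_real (f x)))\<^sup>2)"
    using int by (subst integrable_completion) auto
  ultimately show "(\<lambda>x. complex_of_real (f x)) \<in> L2"
    by (simp add: L2_def)
qed

lemma L2_inner_of_real:
  fixes f g :: "real \<Rightarrow> real"
  assumes [measurable]: "f \<in> borel_measurable borel" "g \<in> borel_measurable borel"
  shows "L2_inner (\<lambda>x. complex_of_real (f x)) (\<lambda>x. complex_of_real (g x)) = of_real (LINT x|lborel. f x * g x)"
proof -
  have "L2_inner (\<lambda>x. complex_of_real (f x)) (\<lambda>x. complex_of_real (g x)) =
      (LINT x|lborel. complex_of_real (f x * g x))"
    unfolding L2_inner_def by (subst integral_completion) simp_all
  then show ?thesis by (simp only: integral_complex_of_real)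
qed

section \<open>The primitive of u with respect to dP and its quadratic form\<close>

definition primitive_dP :: "(real set \<Rightarrow> real) \<Rightarrow> (real \<Rightarrow> real) \<Rightarrow> real \<Rightarrow> real" where
  "primitive_dP P u x = primitive_wrt (pos_measure P) u x - primitive_wrt (neg_measure P) u x"

text \<open>The integral of |u| with respect to the total variation of dP; it bounds the primitive
  uniformly.\<close>

definition total_dP :: "(real set \<Rightarrow> real) \<Rightarrow> (real \<Rightarrow> real) \<Rightarrow> real" where
  "total_dP P u = (LINT x|pos_measure P. \<bar>u x\<bar>) + (LINT x|neg_measure P. \<bar>u x\<bar>)"

context
  fixes P :: "real set \<Rightarrow> real" and u u' :: "real \<Rightarrow> real" and \<alpha> \<beta> :: real
  assumes P: "signed_borel_measure P"
    and deriv: "\<And>x. (u has_real_derivative u' x) (at x)"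
    and u_continuous': "continuous_on UNIV u'"
    and supp: "\<forall>x. x \<notin> {\<alpha>..\<beta>} \<longrightarrow> u x = 0"
begin

interpretation p: locally_finite_borel_measure "pos_measure P"
  using locally_finite_pos_measure[OF P] .
interpretation m: locally_finite_borel_measure "neg_measure P"
  using locally_finite_neg_measure[OF P] .

lemma u_continuous: "continuous_on UNIV u"
  by (rule has_real_derivative_imp_continuous_on_UNIV[OF deriv])

lemma abs_u_support: "\<forall>x. x \<notin> {\<alpha>..\<beta>} \<longrightarrow> \<bar>u x\<bar> = 0"
  using supp by simp

lemma abs_u_continuous: "continuous_on UNIV (\<lambda>x. \<bar>u x\<bar>)"
  using u_continuous by (intro continuous_intros)

lemma signed_integral_of_real:
  "signed_integral P E (\<lambda>x. complex_of_real (u x)) =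
     of_real ((LINT x:E|pos_measure P. u x) - (LINT x:E|neg_measure P. u x))"
  by (simp add: signed_integral_def set_integral_complex_of_real)

text \<open>The primitive is left-continuous, so its left limits are its values and a half-open
  interval receives exactly the increment.\<close>

lemma signed_integral_is_borel_measure:
  "is_borel_measure_of (\<lambda>x. complex_of_real (primitive_dP P u x))
     (\<lambda>E. signed_integral P E (\<lambda>x. complex_of_real (u x)))"
  unfolding is_borel_measure_of_def signed_integral_of_real
proof (intro conjI allI impI)
  show "signed_borel_measure (\<lambda>E. Re (of_real ((LINT x:E|pos_measure P. u x) - (LINT x:E|neg_measure P. u x))))"
    using signed_borel_measure_diff[OF p.signed_borel_measure_set_integral[OF u_continuous supp]
        m.signed_borel_measure_set_integral[OF u_continuous supp]] by simp
  show "signed_borel_measure (\<lambda>E. Im (of_real ((LINT x:E|pos_measure P. u x) - (LINT x:E|neg_measure P. u x))))"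
    by (simp add: signed_borel_measure_def)
  fix a b :: real assume "a < b"
  have "Lim (at_left x) (\<lambda>x. complex_of_real (primitive_dP P u x)) = of_real (primitive_dP P u x)" for x
    unfolding primitive_dP_def
    by (intro Lim_at_left_real tendsto_of_real tendsto_diff
        p.primitive_left_continuous[OF u_continuous supp]
        m.primitive_left_continuous[OF u_continuous supp])
  then show "of_real ((LINT x:{a..<b}|pos_measure P. u x) - (LINT x:{a..<b}|neg_measure P. u x)) =
      Lim (at_left b) (\<lambda>x. complex_of_real (primitive_dP P u x)) -
      Lim (at_left a) (\<lambda>x. complex_of_real (primitive_dP P u x))"
    using p.set_integral_Ico_primitive[OF u_continuous supp]
      m.set_integral_Ico_primitive[OF u_continuous supp]
      \<open>a < b\<close>
    by (simp add: primitive_dP_def)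
qed

lemma primitive_dP_locally_bounded_variation:
  "locally_bounded_variation (\<lambda>x. complex_of_real (primitive_dP P u x))"
proof -
  \<comment> \<open>G is the primitive of |u| with respect to the total variation of dP. It
    dominates the increments, so the variation sums telescope to a bound common to all
    intervals.\<close>
  define G where "G x = primitive_wrt (pos_measure P) (\<lambda>x. \<bar>u x\<bar>) x +
      primitive_wrt (neg_measure P) (\<lambda>x. \<bar>u x\<bar>) x" for x
  have G: "\<bar>G x\<bar> \<le> total_dP P u" for x
    using p.primitive_abs_le[OF abs_u_continuous abs_u_support, of x]
      m.primitive_abs_le[OF abs_u_continuous abs_u_support, of x]
    unfolding G_def total_dP_def by simp
  have step: "norm (complex_of_real (primitive_dP P u b) - complex_of_real (primitive_dP P u a)) \<le> G b - G a"
    if "a \<le> b" for a b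
    using p.primitive_variation_le[OF u_continuous supp that]
      m.primitive_variation_le[OF u_continuous supp that]
    unfolding of_real_diff[symmetric] norm_of_real primitive_dP_def G_def by linarith
  have "(\<Sum>i<n. norm (complex_of_real (primitive_dP P u (t (Suc i))) - complex_of_real (primitive_dP P u (t i))))
      \<le> 2 * total_dP P u"
    if t: "mono t" for n :: nat and t
  proof -
    have "(\<Sum>i<n. norm (complex_of_real (primitive_dP P u (t (Suc i))) - complex_of_real (primitive_dP P u (t i))))
        \<le> (\<Sum>i<n. G (t (Suc i)) - G (t i))"
      using t by (intro sum_mono step) (simp add: monoD)
    also have "\<dots> = G (t n) - G (t 0)" by (rule sum_lessThan_telescope)
    also have "\<dots> \<le> 2 * total_dP P u" using G[of "t n"] G[of "t 0"] by linarith
    finally show ?thesis .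
  qed
  then show ?thesis unfolding locally_bounded_variation_def by blast
qed

text \<open>All bounded Borel subsets of a set that is null for the signed measure have measure 0,
  in particular its intersections with the two Hahn sets. It is therefore null for both Jordan
  parts.\<close>

lemma primitive_dP_AC_loc_wrt: "(\<lambda>x. complex_of_real (primitive_dP P u x)) \<in> AC_loc_wrt P"
proof -
  have "signed_integral P E (\<lambda>x. complex_of_real (u x)) = 0"
    if E: "E \<in> bounded_borel" "signed_null_set P E" for E
  proof -
    note W = hahn_negative_set_borel[OF P]
    have "E - hahn_negative_set P \<in> bounded_borel" "E \<inter> hahn_negative_set P \<in> bounded_borel"
      using E(1) W by (auto intro: bounded_borel_subset simp: bounded_borel_def bounded_Int bounded_diff)
    then have "P (E - hahn_negative_set P) = 0" "P (E \<inter> hahn_negative_set P) = 0"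
      using E(2) unfolding signed_null_set_def by blast+
    then have "E \<in> null_sets (pos_measure P)" "E \<in> null_sets (neg_measure P)"
      using emeasure_pos_measure[OF P E(1)] emeasure_neg_measure[OF P E(1)] E(1)
      by (auto simp: null_sets_def bounded_borel_def)
    then show ?thesis
      by (simp add: signed_integral_of_real set_integral_null_set_eq_0)
  qed
  then show ?thesis
    using primitive_dP_locally_bounded_variation signed_integral_is_borel_measure
    unfolding AC_loc_wrt_def by blast
qed

lemma primitive_dP_is_quasi_derivative:
  "is_quasi_derivative P (\<lambda>x. complex_of_real (primitive_dP P u x)) (\<lambda>x. complex_of_real (u x))"
proof -
  have "signed_locally_integrable P (\<lambda>x. complex_of_real (u x))"
    unfolding signed_locally_integrable_def complex_of_real_integrable_eq[symmetric]
    using p.set_integrable_compact_support[OF u_continuous supp]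
      m.set_integrable_compact_support[OF u_continuous supp]
    by (simp add: set_integrable_def scaleR_conv_of_real flip: of_real_mult)
  then show ?thesis
    unfolding is_quasi_derivative_def using signed_integral_is_borel_measure by blast
qed

lemma primitive_dP_borel_measurable [measurable]: "primitive_dP P u \<in> borel_measurable borel"
  unfolding primitive_dP_def[abs_def]
  using p.primitive_borel_measurable[OF u_continuous supp]
    m.primitive_borel_measurable[OF u_continuous supp] by measurable

lemma abs_primitive_dP_le: "\<bar>primitive_dP P u x\<bar> \<le> total_dP P u"
  using p.primitive_abs_le[OF u_continuous supp, of x]
      m.primitive_abs_le[OF u_continuous supp, of x]
  unfolding primitive_dP_def total_dP_def by linarith

text \<open>Integration by parts for each Jordan part; the sign in H f = - u' cancels the one it
  produces.\<close>

lemma primitive_dP_form: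
  "Re (L2_inner (\<lambda>x. - of_real (u' x)) (\<lambda>x. complex_of_real (primitive_dP P u x))) =
     (LINT x|pos_measure P. (u x)\<^sup>2) - (LINT x|neg_measure P. (u x)\<^sup>2)"
proof -
  have [measurable]: "u' \<in> borel_measurable borel"
    using u_continuous' by (rule borel_measurable_continuous_onI)
  have "L2_inner (\<lambda>x. complex_of_real (- u' x)) (\<lambda>x. complex_of_real (primitive_dP P u x)) =
      of_real (LINT x|lborel. - u' x * primitive_dP P u x)"
    by (rule L2_inner_of_real) measurable
  also have "(LINT x|lborel. - u' x * primitive_dP P u x) =
      (LINT x|lborel. u' x * primitive_wrt (neg_measure P) u x - u' x * primitive_wrt (pos_measure P) u x)"
    by (simp add: primitive_dP_def algebra_simps)
  also have "\<dots> = (LINT x|pos_measure P. (u x)\<^sup>2) - (LINT x|neg_measure P. (u x)\<^sup>2)"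
    using p.primitive_integration_by_parts[OF deriv u_continuous' supp]
      m.primitive_integration_by_parts[OF deriv u_continuous' supp] by simp
  finally show ?thesis by simp
qed

context
  assumes total_zero: "(LINT x|pos_measure P. u x) = (LINT x|neg_measure P. u x)"
begin

text \<open>To the right of the support of u the primitive is constant, equal to the integral of u
  with respect to dP. This is where the vanishing of that integral enters.\<close>

lemma primitive_dP_compact_support: "\<forall>x. x \<notin> {\<alpha>..\<beta>} \<longrightarrow> primitive_dP P u x = 0"
  using p.primitive_below[OF u_continuous supp]
    m.primitive_below[OF u_continuous supp]
    p.primitive_above[OF u_continuous supp]
    m.primitive_above[OF u_continuous supp] total_zero
  unfolding primitive_dP_def by (auto simp: not_le)

lemma primitive_dP_in_H_graph:
  "(\<lambda>x. complex_of_real (primitive_dP P u x), \<lambda>x. - of_real (u' x)) \<in> H_graph P"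
proof -
  note supp' = p.derivative_compact_support[OF deriv u_continuous' supp]
  have [measurable]: "u' \<in> borel_measurable borel"
    using u_continuous' by (rule borel_measurable_continuous_onI)
  obtain B where B: "\<And>x. \<bar>u' x\<bar> \<le> B"
    using p.bounded_compact_support[OF u_continuous' supp'] by blast
  \<comment> \<open>The function u is differentiable everywhere, so the second component in
    \<open>H_graph\<close> is - u' pointwise.\<close>
  have "vector_derivative (\<lambda>x. complex_of_real (u x)) (at x) = of_real (u' x)" for x
    using deriv[of x] by (intro vector_derivative_at has_vector_derivative_of_real)
      (simp add: has_real_derivative_iff_has_vector_derivative)
  moreover have "(\<lambda>x. complex_of_real (u' x)) \<in> L2"
    by (rule bounded_compact_support_in_L2(2)[OF _ B supp']) measurable
  moreover have "(\<lambda>x. complex_of_real (primitive_dP P u x)) \<in> L2"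
    by (rule bounded_compact_support_in_L2(2)[OF _ abs_primitive_dP_le primitive_dP_compact_support]) measurable
  moreover note primitive_dP_AC_loc_wrt primitive_dP_is_quasi_derivative
    bounded_derivative_in_AC_loc[OF deriv B]
  ultimately show ?thesis
    unfolding H_graph_def
    by (intro CollectI exI[of _ "\<lambda>x. complex_of_real (primitive_dP P u x)"] exI[of _ "\<lambda>x. complex_of_real (u x)"]) simp
qed

text \<open>The upper bound is the squared supremum bound times the length of the support, which is
  small when both bumps sit in a short interval.\<close>

lemma primitive_dP_norm:
  assumes "\<alpha> \<le> \<beta>"
  defines "f \<equiv> \<lambda>x. complex_of_real (primitive_dP P u x)"
  shows "0 \<le> Re (L2_inner f f)"
    "Re (L2_inner f f)
      \<le> (total_dP P u)\<^sup>2 * (\<beta> - \<alpha>)"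
proof -
  have eq: "Re (L2_inner f f) =
      (LINT x|lborel. (primitive_dP P u x)\<^sup>2)"
    unfolding f_def by (subst L2_inner_of_real) (auto simp: power2_eq_square)
  have sq: "(primitive_dP P u x)\<^sup>2 \<le> (total_dP P u)\<^sup>2" for x
    using abs_primitive_dP_le[of x] by (metis abs_ge_zero power2_abs power_mono)
  show "0 \<le> Re (L2_inner f f)"
    unfolding eq by simp
  have "(LINT x|lborel. (primitive_dP P u x)\<^sup>2) \<le> (LINT x|lborel. indicator {\<alpha>..\<beta>} x * (total_dP P u)\<^sup>2)"
  proof (rule integral_mono)
    show "integrable lborel (\<lambda>x. (primitive_dP P u x)\<^sup>2)"
      by (rule bounded_compact_support_in_L2(1)[OF _ abs_primitive_dP_le primitive_dP_compact_support]) measurable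
    show "integrable lborel (\<lambda>x. indicator {\<alpha>..\<beta>} x * (total_dP P u)\<^sup>2)"
      by (intro integrable_mult_left) (auto simp: integrable_indicator_iff emeasure_lborel_Icc_eq)
    show "(primitive_dP P u x)\<^sup>2 \<le> indicator {\<alpha>..\<beta>} x * (total_dP P u)\<^sup>2" for x
      using sq[of x] primitive_dP_compact_support by (auto simp: indicator_def)
  qed
  also have "\<dots> = (total_dP P u)\<^sup>2 * (\<beta> - \<alpha>)"
    using assms by simp
  finally show "Re (L2_inner f f)
      \<le> (total_dP P u)\<^sup>2 * (\<beta> - \<alpha>)"
    unfolding eq .
qed

end

end

section \<open>Support points of the negative part and the contradiction\<close>

lemma support_point_negative_set:
  assumes \<nu>: "signed_borel_measure \<nu>" and sing: "lebesgue_singular \<nu>"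
    and x: "x \<in> topological_support (neg_part_measure \<nu>)" and I: "open I" "x \<in> I"
  obtains E where "E \<in> sets borel" "E \<subseteq> I" "emeasure (pos_measure (lebesgue_plus \<nu>)) E = 0"
    "0 < emeasure (neg_measure (lebesgue_plus \<nu>)) E"
proof -
  let ?P = "lebesgue_plus \<nu>" and ?W = "hahn_negative_set \<nu>"
  let ?V = "hahn_negative_set ?P"
  note P = signed_borel_measure_lebesgue_plus[OF \<nu>]
  obtain E where E: "E \<in> bounded_borel" "E \<subseteq> I" "neg_part_measure \<nu> E \<noteq> 0"
    using x I unfolding topological_support_def by blast
  obtain N where N: "N \<in> null_sets lborel" "\<And>E. E \<in> bounded_borel \<Longrightarrow> E \<inter> N = {} \<Longrightarrow> \<nu> E = 0"
    using sing unfolding lebesgue_singular_def by blast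
  have NB: "N \<in> sets borel" using N(1) by (simp add: null_sets_def)
  \<comment> \<open>The Lebesgue-null set N carries \<nu>, so on its subsets dP and \<nu> agree; the
    Hahn set of \<nu> makes the value negative.\<close>
  define E1 where "E1 = E \<inter> ?W \<inter> N"
  have EW: "E \<inter> ?W \<in> bounded_borel"
    using E(1) hahn_negative_set_borel[OF \<nu>] by (rule bounded_borel_Int_borel)
  have E1: "E1 \<in> bounded_borel" unfolding E1_def using EW NB by (rule bounded_borel_Int_borel)
  have "\<nu> (E \<inter> ?W - E1) = \<nu> (E \<inter> ?W) - \<nu> E1"
    by (rule signed_Diff[OF \<nu> EW E1]) (auto simp: E1_def)
  moreover have "\<nu> (E \<inter> ?W - E1) = 0"
    by (rule N(2)[OF bounded_borel_Diff[OF EW E1]]) (auto simp: E1_def)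
  ultimately have \<nu>E1: "\<nu> E1 < 0"
    using neg_part_nonpos[OF \<nu> E(1)] E(3) by (simp add: neg_part_measure_def)
  have "E1 \<in> null_sets lborel"
    using E1 by (intro null_sets_subset[OF N(1)]) (auto simp: E1_def bounded_borel_def)
  then have "?P E1 = \<nu> E1"
    by (simp add: lebesgue_plus_def measure_def null_sets_def)
  \<comment> \<open>The Jordan parts of dP refer to the Hahn set chosen for dP, which may differ
    from that of \<nu>. Removing the part of E1 outside it, of nonnegative dP-measure, leaves a set
    of still strictly negative measure.\<close>
  moreover have "0 \<le> ?P (E1 - ?V)"
    using pos_part_nonneg[OF P E1] by (simp add: pos_part_measure_def Diff_eq)
  moreover have E2: "E1 \<inter> ?V \<in> bounded_borel"
    using E1 hahn_negative_set_borel[OF P] by (rule bounded_borel_Int_borel)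
  moreover have "?P (E1 - ?V) = ?P E1 - ?P (E1 \<inter> ?V)"
    using signed_Diff[OF P E1 E2] by (simp add: Diff_Int)
  ultimately have neg: "?P (E1 \<inter> ?V) < 0" using \<nu>E1 by linarith
  show thesis
  proof
    show "E1 \<inter> ?V \<in> sets borel" using E2 by (rule bounded_borel_sets)
    show "E1 \<inter> ?V \<subseteq> I" using E(2) by (auto simp: E1_def)
    have "E1 \<inter> ?V - ?V = {}" by blast
    then show "emeasure (pos_measure ?P) (E1 \<inter> ?V) = 0"
      using emeasure_pos_measure[OF P E2] signed_empty[OF P] by (metis ennreal_0)
    show "0 < emeasure (neg_measure ?P) (E1 \<inter> ?V)"
      using emeasure_neg_measure[OF P E2] neg by (simp add: Int_assoc)
  qed
qed

text \<open>Bolzano-Weierstrass gives an accumulation point; two distinct points of S within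
  \<epsilon> / 2 of it are less than \<epsilon> apart.\<close>

lemma infinite_bounded_close_points:
  fixes S :: "real set"
  assumes "infinite S" "S \<subseteq> {a..b}" "0 < \<epsilon>"
  obtains p q where "p \<in> S" "q \<in> S" "p < q" "q - p < \<epsilon>"
proof -
  obtain x where "x islimpt S"
    using compact_eq_Bolzano_Weierstrass[of "{a..b}"] assms(1,2) by auto
  then have inf: "infinite (S \<inter> ball x (\<epsilon> / 2))"
    using assms(3) unfolding islimpt_eq_infinite_ball by simp
  then obtain y where y: "y \<in> S \<inter> ball x (\<epsilon> / 2)"
    using infinite_imp_nonempty by blast
  have "infinite (S \<inter> ball x (\<epsilon> / 2) - {y})"
    using inf by simp
  then obtain z where z: "z \<in> S \<inter> ball x (\<epsilon> / 2) - {y}"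
    using infinite_imp_nonempty by blast
  show thesis
  proof (cases "y < z")
    case True
    have "z - y < \<epsilon>" using y z unfolding Int_iff Diff_iff mem_ball dist_real_def by linarith
    then show thesis using that[of y z] True y z by blast
  next
    case False
    have "y - z < \<epsilon>" using y z unfolding Int_iff Diff_iff mem_ball dist_real_def by linarith
    then show thesis using that[of z y] False y z by force
  qed
qed

theorem corollary5p6:
  fixes \<nu> :: "real set \<Rightarrow> real"
  assumes "signed_borel_measure \<nu>"
    and "lebesgue_singular \<nu>"
    and "lower_semibounded (H_graph (lebesgue_plus \<nu>))"
  shows "discrete_measure (neg_part_measure \<nu>)"
  unfolding discrete_measure_def
proof (intro allI, rule ccontr)
  fix a b :: real
  let ?P = "lebesgue_plus \<nu>"
  let ?S = "topological_support (neg_part_measure \<nu>) \<inter> {a..b}"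
  assume inf: "infinite ?S"
  note P = signed_borel_measure_lebesgue_plus[OF assms(1)]
  interpret p: locally_finite_borel_measure "pos_measure ?P"
    using locally_finite_pos_measure[OF P] .
  interpret m: locally_finite_borel_measure "neg_measure ?P"
    using locally_finite_neg_measure[OF P] .
  obtain c where c: "\<And>f h. (f, h) \<in> H_graph ?P \<Longrightarrow> c * Re (L2_inner f f) \<le> Re (L2_inner h f)"
    using assms(3) unfolding lower_semibounded_def by blast
  \<comment> \<open>All intervals around points of [a, b] used below have radius less than 1, so one
    bound serves for every bump. The summand 1 makes it positive.\<close>
  define B where "B = measure (neg_measure ?P) {a - 1..b + 1} + 1"
  have B: "0 < B" unfolding B_def by (simp add: add_nonneg_pos)
  \<comment> \<open>The factor 96 = 3 * 32 makes 32 \<epsilon> |c| at most 1 / (3 B); |c| + 1 covers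
    the case c = 0.\<close>
  define \<epsilon> where "\<epsilon> = min 1 (1 / (96 * B * (\<bar>c\<bar> + 1)))"
  have \<epsilon>: "0 < \<epsilon>" "\<epsilon> \<le> 1" "32 * \<epsilon> * \<bar>c\<bar> \<le> 1 / (3 * B)"
  proof -
    show "0 < \<epsilon>" "\<epsilon> \<le> 1" using B by (simp_all add: \<epsilon>_def)
    have "32 * \<epsilon> * \<bar>c\<bar> \<le> 32 * (1 / (96 * B * (\<bar>c\<bar> + 1))) * (\<bar>c\<bar> + 1)"
      using \<open>0 < \<epsilon>\<close> by (intro mult_mono) (auto simp: \<epsilon>_def)
    also have "\<dots> = 1 / (3 * B)"
      using B by (simp add: divide_simps)
    finally show "32 * \<epsilon> * \<bar>c\<bar> \<le> 1 / (3 * B)" .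
  qed
  obtain s t where st: "s \<in> ?S" "t \<in> ?S" "s < t" "t - s < \<epsilon>"
    using infinite_bounded_close_points[OF inf _ \<epsilon>(1)] by blast
  \<comment> \<open>A third of the gap keeps the intervals of radius r around s and t apart.\<close>
  define r where "r = (t - s) / 3"
  have r: "0 < r" "r < \<epsilon> / 3" using st by (simp_all add: r_def)
  have concentrated: "\<exists>E. E \<in> sets borel \<and> E \<subseteq> {x - r<..<x + r} \<and>
      emeasure (pos_measure ?P) E = 0 \<and> 0 < emeasure (neg_measure ?P) E"
    and mass: "measure (neg_measure ?P) {x - r..x + r} \<le> B" if x: "x \<in> ?S" for x
  proof -
    have *: "x \<in> topological_support (neg_part_measure \<nu>)" "x \<in> {x - r<..<x + r}"
      using x r by auto
    show "\<exists>E. E \<in> sets borel \<and> E \<subseteq> {x - r<..<x + r} \<and>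
        emeasure (pos_measure ?P) E = 0 \<and> 0 < emeasure (neg_measure ?P) E"
      by (rule support_point_negative_set[OF assms(1,2) *(1) open_greaterThanLessThan *(2)]) blast
    have "measure (neg_measure ?P) {x - r..x + r} \<le> measure (neg_measure ?P) {a - 1..b + 1}"
      using x r \<epsilon>(2) m.finite_interval[of "a - 1" "b + 1"]
      by (intro measure_mono_fmeasurable) (auto simp: fmeasurable_def)
    then show "measure (neg_measure ?P) {x - r..x + r} \<le> B" by (simp add: B_def)
  qed
  obtain E where E: "E \<in> sets borel" "E \<subseteq> {s - r<..<s + r}"
    "emeasure (pos_measure ?P) E = 0" "0 < emeasure (neg_measure ?P) E"
    using concentrated[OF st(1)] by blast
  obtain \<psi> \<psi>' where \<psi>: "\<And>y. (\<psi> has_real_derivative \<psi>' y) (at y)" "continuous_on UNIV \<psi>'"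
    "\<And>y. y \<notin> {s - r<..<s + r} \<Longrightarrow> \<psi> y = 0"
    "(LINT y|pos_measure ?P. \<psi> y) - (LINT y|neg_measure ?P. \<psi> y) = 1"
    "(LINT y|pos_measure ?P. \<bar>\<psi> y\<bar>) + (LINT y|neg_measure ?P. \<bar>\<psi> y\<bar>) \<le> 2"
    "(LINT y|pos_measure ?P. (\<psi> y)\<^sup>2) - (LINT y|neg_measure ?P. (\<psi> y)\<^sup>2) \<le> - 1 / (3 * B)"
    by (rule exists_normalized_bump[OF p.locally_finite_borel_measure_axioms
          m.locally_finite_borel_measure_axioms E mass[OF st(1)]]) (rule that)
  obtain F where F: "F \<in> sets borel" "F \<subseteq> {t - r<..<t + r}"
    "emeasure (pos_measure ?P) F = 0" "0 < emeasure (neg_measure ?P) F"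
    using concentrated[OF st(2)] by blast
  obtain \<theta> \<theta>' where \<theta>: "\<And>y. (\<theta> has_real_derivative \<theta>' y) (at y)" "continuous_on UNIV \<theta>'"
    "\<And>y. y \<notin> {t - r<..<t + r} \<Longrightarrow> \<theta> y = 0"
    "(LINT y|pos_measure ?P. \<theta> y) - (LINT y|neg_measure ?P. \<theta> y) = 1"
    "(LINT y|pos_measure ?P. \<bar>\<theta> y\<bar>) + (LINT y|neg_measure ?P. \<bar>\<theta> y\<bar>) \<le> 2"
    "(LINT y|pos_measure ?P. (\<theta> y)\<^sup>2) - (LINT y|neg_measure ?P. (\<theta> y)\<^sup>2) \<le> - 1 / (3 * B)"
    by (rule exists_normalized_bump[OF p.locally_finite_borel_measure_axioms
          m.locally_finite_borel_measure_axioms F mass[OF st(2)]]) (rule that)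
  have int: "integrable M \<psi>" "integrable M \<theta>" "integrable M (\<lambda>y. (\<psi> y)\<^sup>2)" "integrable M (\<lambda>y. (\<theta> y)\<^sup>2)"
    if "locally_finite_borel_measure M" for M
  proof -
    interpret locally_finite_borel_measure M by fact
    have cont: "continuous_on UNIV \<psi>" "continuous_on UNIV \<theta>"
      using \<psi>(1) \<theta>(1) DERIV_isCont by (simp_all add: continuous_on_eq_continuous_at) blast+
    then have cont2: "continuous_on UNIV (\<lambda>y. (\<psi> y)\<^sup>2)" "continuous_on UNIV (\<lambda>y. (\<theta> y)\<^sup>2)"
      by (auto intro: continuous_on_power)
    show "integrable M \<psi>" "integrable M (\<lambda>y. (\<psi> y)\<^sup>2)"
      using \<psi>(3) by (auto intro!: integrable_compact_support[OF cont(1), of "s - r" "s + r"]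
          integrable_compact_support[OF cont2(1), of "s - r" "s + r"])
    show "integrable M \<theta>" "integrable M (\<lambda>y. (\<theta> y)\<^sup>2)"
      using \<theta>(3) by (auto intro!: integrable_compact_support[OF cont(2), of "t - r" "t + r"]
          integrable_compact_support[OF cont2(2), of "t - r" "t + r"])
  qed
  note ip = int[OF p.locally_finite_borel_measure_axioms] and im = int[OF m.locally_finite_borel_measure_axioms]
  \<comment> \<open>Both bumps have signed integral 1, so the difference has integral 0 and its
    primitive belongs to the domain. Since their supports are disjoint, the squares add without a
    cross term.\<close>
  define u where "u y = \<psi> y - \<theta> y" for y
  define u' where "u' y = \<psi>' y - \<theta>' y" for y
  have u1: "(u has_real_derivative u' y) (at y)" for y
    unfolding u_def[abs_def] u'_def using \<psi>(1) \<theta>(1) by (rule DERIV_diff)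
  have u2: "continuous_on UNIV u'"
    unfolding u'_def[abs_def] using \<psi>(2) \<theta>(2) by (rule continuous_on_diff)
  have u3: "\<forall>y. y \<notin> {s - r..t + r} \<longrightarrow> u y = 0"
    using \<psi>(3) \<theta>(3) st(3) by (auto simp: u_def)
  have u4: "(LINT y|pos_measure ?P. u y) = (LINT y|neg_measure ?P. u y)"
    unfolding u_def using ip im \<psi>(4) \<theta>(4) by simp
  have "3 * r = t - s" by (simp add: r_def)
  then have "s + r < t - r" using r(1) by linarith
  then have "\<psi> y * \<theta> y = 0" for y
    using \<psi>(3)[of y] \<theta>(3)[of y] by (cases "y < s + r") auto
  then have sq: "(u y)\<^sup>2 = (\<psi> y)\<^sup>2 + (\<theta> y)\<^sup>2" for y
    by (simp add: u_def power2_diff mult.assoc)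
  have form: "(LINT y|pos_measure ?P. (u y)\<^sup>2) - (LINT y|neg_measure ?P. (u y)\<^sup>2) \<le> - 2 / (3 * B)"
    unfolding sq using ip im \<psi>(6) \<theta>(6) by simp
  have abs_le: "(LINT y|M. \<bar>u y\<bar>) \<le> (LINT y|M. \<bar>\<psi> y\<bar>) + (LINT y|M. \<bar>\<theta> y\<bar>)"
    if "locally_finite_borel_measure M" for M
  proof -
    have "(LINT y|M. \<bar>u y\<bar>) \<le> (LINT y|M. \<bar>\<psi> y\<bar> + \<bar>\<theta> y\<bar>)"
      unfolding u_def using int[OF that] by (intro integral_mono) auto
    then show ?thesis using int[OF that] by simp
  qed
  let ?f = "\<lambda>x. complex_of_real (primitive_dP ?P u x)"
  \<comment> \<open>Each of the two bumps contributes at most 2.\<close>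
  have T: "0 \<le> total_dP ?P u" "total_dP ?P u \<le> 4"
    using abs_le[OF p.locally_finite_borel_measure_axioms] abs_le[OF m.locally_finite_borel_measure_axioms]
      \<psi>(5) \<theta>(5) by (simp_all add: total_dP_def)
  have "s - r \<le> t + r" using st(3) r by simp
  note norm = primitive_dP_norm[OF P u1 u2 u3 u4 this]
  have "Re (L2_inner ?f ?f) \<le> (total_dP ?P u)\<^sup>2 * (t + r - (s - r))"
    using norm(2) .
  \<comment> \<open>The length is t - s + 2 r, less than \<epsilon> + 2 \<epsilon> / 3. The product
    16 * 2 is the 32 in the choice of \<epsilon>.\<close>
  also have "\<dots> \<le> 4\<^sup>2 * (2 * \<epsilon>)"
    using T st r by (intro mult_mono power_mono) auto
  finally have "\<bar>c\<bar> * Re (L2_inner ?f ?f) \<le> \<bar>c\<bar> * (32 * \<epsilon>)"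
    by (intro mult_left_mono) auto
  \<comment> \<open>Passing to - |c| covers both signs of c.\<close>
  moreover have "- \<bar>c\<bar> * Re (L2_inner ?f ?f) \<le> c * Re (L2_inner ?f ?f)"
    using norm(1) by (intro mult_right_mono) auto
  moreover have "c * Re (L2_inner ?f ?f) \<le> - 2 / (3 * B)"
    using c[OF primitive_dP_in_H_graph[OF P u1 u2 u3 u4]] form
    unfolding primitive_dP_form[OF P u1 u2 u3] by linarith
  \<comment> \<open>The choice of \<epsilon> keeps the right-hand side at most 1 / (3 B), which
    gives the contradiction.\<close>
  ultimately have "2 / (3 * B) \<le> 32 * \<epsilon> * \<bar>c\<bar>"
    by (simp add: mult.commute)
  moreover have "1 / (3 * B) < 2 / (3 * B)"
    using B by (simp add: divide_strict_right_mono)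
  ultimately show False using \<epsilon>(3) by linarith
qed

end
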